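(* Let $0<r\le n$, $R=\{1,\ldots,r\}$, $N=\{1,\ldots,n\}$, and let $\psi:\widetilde{A}(r,d,\underline{\widetilde q})\to A(n,d,\underline q)$ be a $\Bbbk$-algebra homomorphism. Then there exist an injective map $w:R\to N$, $(\tau_1,\ldots,\tau_r)\in\{0,1\}^r$, $(m_1,\ldots,m_r)\in(\mathbb{Z}\setminus\{0\})^r$, $(\gamma_1,\ldots,\gamma_r),(b_1,\ldots,b_r)\in(\Bbbk^* )^r$, an integer matrix $(t_{i,j})\in\mathcal{M}_{r,n}(\mathbb{Z})$, and Laurent polynomials $p_i(h_{w(i)}),p_i'(h_{w(i)})\in\Bbbk[h_{w(i)}^{\pm1}]$ ($i\in R$) such that: (i) $q_{w(i)}^{(-1)^{\tau_i}m_i}=\widetilde q_i$ for all $i\in R$; (ii) $q_{w(i)}^{t_{l,w(i)}(1-\tau_i)}\,q_{w(i)}^{-t_{l,w(i)}\tau_i}\,q_{w(l)}^{-t_{i,w(l)}(1-\tau_l)}\,q_{w(l)}^{t_{i,w(l)}\tau_l}=1$ for all $i,l\in R$; (iii) $p_i(h_{w(i)})\,p_i'(h_{w(i)})\,a_d\big(q_{w(i)}^{1-\tau_i}h_{w(i)}\big)=a_d\big(\widetilde q_i\gamma_ih_{w(i)}^{m_i}\big)$ for all $i\in R$; (iv) $\gamma_i^d=\widetilde q_i^{-\tau_id}$ and, for all $i\in R$, $\psi(\widetilde h_i)=\gamma_ih_{w(i)}^{m_i}$, $\psi(\widetilde x_i)=p_i(h_{w(i)})\,b_i\,h_1^{t_{i,1}}\cdots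 h_n^{t_{i,n}}\,x_{w(i)}^{1-\tau_i}y_{w(i)}^{\tau_i}$, $\psi(\widetilde y_i)=x_{w(i)}^{\tau_i}y_{w(i)}^{1-\tau_i}\,p_i'(h_{w(i)})\,b_i^{-1}\,h_1^{-t_{i,1}}\cdots h_n^{-t_{i,n}}$.
   Context: Let $\Bbbk$ be a field, $d\ge1$, and write $a_d(X)=X^d-1$. For a positive integer $n$ and $\underline{q}=(q_1,\ldots,q_n)\in(\Bbbk^* )^n$ with $q_i^d\neq1$ for all $i$, $A(n,d,\underline{q})$ is the $\Bbbk$-algebra generated by $x_i,y_i,h_i,h_i^{-1}$ ($1\le i\le n$) subject to $h_ih_i^{-1}=h_i^{-1}h_i=1$, $x_ih_i=q_ih_ix_i$, $y_ih_i=q_i^{-1}h_iy_i$, $x_iy_i=(q_ih_i)^d-1$, $y_ix_i=h_i^d-1$, and, for $i\neq j$, each of $h_i^{\pm1},x_i,y_i$ commutes with each of $h_j^{\pm1},x_j,y_j$. For $\underline{\widetilde q}=(\widetilde q_1,\ldots,\widetilde q_r)\in(\Bbbk^* )^r$ with $\widetilde q_i^d\ne1$, $\widetilde A(r,d,\underline{\widetilde q})$ denotes the algebra $A(r,d,\underline{\widetilde q})$ with its generators written $\widetilde x_i,\widetilde y_i,\widetilde h_i^{\pm1}$. Exponents such as $x^{1-\tau_i}y^{\tau_i}$ with $\tau_i\in\{0,1\}$ mean $x$ if $\tau_i=0$ and $y$ if $\tau_i=1$. *)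

theory Defs
  imports Main
begin

datatype gen = GH nat | GHi nat | GX nat | GY nat

fun gidx :: "gen \<Rightarrow> nat" where
  "gidx (GH i) = i" | "gidx (GHi i) = i" | "gidx (GX i) = i" | "gidx (GY i) = i"

text \<open>Noncommutative series: coefficient functions on words. The free algebra consists of
  the finitely supported ones whose words only use generators with index in 1..n.\<close>
type_synonym 'k fa = "gen list \<Rightarrow> 'k"

definition fa_zero :: "'k::field fa" where "fa_zero = (\<lambda>w. 0)"
definition fa_one :: "'k::field fa" where "fa_one = (\<lambda>w. if w = [] then 1 else 0)"
definition fa_gen :: "gen \<Rightarrow> 'k::field fa" where "fa_gen g = (\<lambda>w. if w = [g] then 1 else 0)"
definition fa_add :: "'k::field fa \<Rightarrow> 'k fa \<Rightarrow> 'k fa" where "fa_add f g = (\<lambda>w. f w + g w)"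
definition fa_diff :: "'k::field fa \<Rightarrow> 'k fa \<Rightarrow> 'k fa" where "fa_diff f g = (\<lambda>w. f w - g w)"
definition fa_scal :: "'k::field \<Rightarrow> 'k fa \<Rightarrow> 'k fa" where "fa_scal c f = (\<lambda>w. c * f w)"
definition fa_mult :: "'k::field fa \<Rightarrow> 'k fa \<Rightarrow> 'k fa" where
  "fa_mult f g = (\<lambda>w. \<Sum>i\<le>length w. f (take i w) * g (drop i w))"

definition free_alg :: "nat \<Rightarrow> 'k::field fa set" where
  "free_alg n = {f. finite {w. f w \<noteq> 0} \<and> (\<forall>w. f w \<noteq> 0 \<longrightarrow> (\<forall>g\<in>set w. gidx g \<in> {1..n}))}"

primrec fa_pow :: "'k::field fa \<Rightarrow> nat \<Rightarrow> 'k fa" where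
  "fa_pow f 0 = fa_one" | "fa_pow f (Suc k) = fa_mult f (fa_pow f k)"

definition hpow :: "nat \<Rightarrow> int \<Rightarrow> 'k::field fa" where
  "hpow i m = (if m \<ge> 0 then fa_pow (fa_gen (GH i)) (nat m) else fa_pow (fa_gen (GHi i)) (nat (- m)))"

definition hmono :: "nat \<Rightarrow> (nat \<Rightarrow> int) \<Rightarrow> 'k::field fa" where
  "hmono n t = foldr (\<lambda>j acc. fa_mult (hpow j (t j)) acc) [1..<Suc n] fa_one"

definition laurent :: "(int \<Rightarrow> 'k::field) set" where
  "laurent = {p. finite {j. p j \<noteq> 0}}"

definition laurent_eval :: "(int \<Rightarrow> 'k::field) \<Rightarrow> nat \<Rightarrow> 'k fa" where
  "laurent_eval p i = (\<lambda>w. \<Sum>j\<in>{j. p j \<noteq> 0}. fa_scal (p j) (hpow i j) w)"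

definition rels :: "nat \<Rightarrow> nat \<Rightarrow> (nat \<Rightarrow> 'k::field) \<Rightarrow> 'k fa set" where
  "rels n d q =
    (\<Union>i\<in>{1..n}.
      (let h = fa_gen (GH i); hi = fa_gen (GHi i); x = fa_gen (GX i); y = fa_gen (GY i) in
       { fa_diff (fa_mult h hi) fa_one,
         fa_diff (fa_mult hi h) fa_one,
         fa_diff (fa_mult x h) (fa_scal (q i) (fa_mult h x)),
         fa_diff (fa_mult y h) (fa_scal (inverse (q i)) (fa_mult h y)),
         fa_diff (fa_mult x y) (fa_diff (fa_scal (q i ^ d) (fa_pow h d)) fa_one),
         fa_diff (fa_mult y x) (fa_diff (fa_pow h d) fa_one) }))
    \<union> {fa_diff (fa_mult (fa_gen a) (fa_gen b)) (fa_mult (fa_gen b) (fa_gen a)) | a b.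
         gidx a \<in> {1..n} \<and> gidx b \<in> {1..n} \<and> gidx a \<noteq> gidx b}"

inductive_set rel_ideal :: "nat \<Rightarrow> nat \<Rightarrow> (nat \<Rightarrow> 'k::field) \<Rightarrow> 'k fa set"
  for n d q where
  zero: "fa_zero \<in> rel_ideal n d q"
| gen: "r \<in> rels n d q \<Longrightarrow> u \<in> free_alg n \<Longrightarrow> v \<in> free_alg n \<Longrightarrow>
          fa_mult u (fa_mult r v) \<in> rel_ideal n d q"
| add: "a \<in> rel_ideal n d q \<Longrightarrow> b \<in> rel_ideal n d q \<Longrightarrow> fa_add a b \<in> rel_ideal n d q"

definition eqA :: "nat \<Rightarrow> nat \<Rightarrow> (nat \<Rightarrow> 'k::field) \<Rightarrow> 'k fa \<Rightarrow> 'k fa \<Rightarrow> bool" where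
  "eqA n d q f g \<longleftrightarrow> fa_diff f g \<in> rel_ideal n d q"

text \<open>A k-algebra homomorphism A~(r,d,q~) -> A(n,d,q), given by a k-algebra homomorphism
  between the free algebras that maps the defining ideal into the defining ideal
  (equivalently, by the universal property, a homomorphism of the quotient algebras).\<close>
definition alg_hom :: "nat \<Rightarrow> (nat \<Rightarrow> 'k::field) \<Rightarrow> nat \<Rightarrow> (nat \<Rightarrow> 'k) \<Rightarrow> nat \<Rightarrow> ('k fa \<Rightarrow> 'k fa) \<Rightarrow> bool" where
  "alg_hom r qt n q d Psi \<longleftrightarrow>
     (\<forall>f\<in>free_alg r. Psi f \<in> free_alg n) \<and>
     Psi fa_one = fa_one \<and>
     (\<forall>f\<in>free_alg r. \<forall>g\<in>free_alg r. Psi (fa_add f g) = fa_add (Psi f) (Psi g)) \<and>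
     (\<forall>c. \<forall>f\<in>free_alg r. Psi (fa_scal c f) = fa_scal c (Psi f)) \<and>
     (\<forall>f\<in>free_alg r. \<forall>g\<in>free_alg r. Psi (fa_mult f g) = fa_mult (Psi f) (Psi g)) \<and>
     (\<forall>f\<in>rel_ideal r d qt. Psi f \<in> rel_ideal n d q)"

end

(*
  Sending x_i to X_i and y_i to (h_i^d - 1) X_i^(-1), where X_i h_i = q_i h_i X_i, embeds A(n,d,q) into a
  quantum torus, a domain graded by an ordered group.  There the factors of a nonzero homogeneous
  product are homogeneous.  The component of X-degree beta of an element of A vanishes at h_j = q_j^k
  for 0 <= k < -beta_j, so a unit of A has X-degree 0 and psi(h_i) is a monomial c h^mu.  Likewise
  psi(x_i) = F X^alpha and psi(y_i) = G X^(-alpha), and their product is a binomial in h^mu with the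
  roots of F and (shifted) of G.  One root forces mu and alpha to be supported at a single index w(i).
  If |alpha_w(i)| were at least 2, two roots would give q_w(i)^(m_i d) = 1, against the condition that
  the d-th power of the parameter of the source is not 1.  As the binomial involves only h_w(i), F and G
  are monomials times polynomials in h_w(i), and (ii) is the commutation of psi(x_i) and psi(x_l).
*)
theory Submission
  imports Defs "HOL-Library.Poly_Mapping" "HOL-Library.Function_Algebras"
begin

text \<open>In the torus every monomial is a unit, so the torus alone is too coarse and A has to be
  recognized inside it. The embedding \<open>symbol\<close> is used in both directions. It kills the
  defining ideal, so relations between images become equations in a domain; and it separates the
  elements of A, so the congruences of the conclusion are proved by comparing symbols. The second
  direction rests on normal forms: the part of A of X-degree \<beta> consists of Laurent polynomials
  times one fixed word in the x and y. The same fact makes F and G multiples of the coefficient of x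
  or y, so that the cofactors p and p' exist in A and not merely in the torus. Injectivity of w
  comes from x_l commuting with h_i for distinct i and l: a common index would give
  \<open>q (w i) powi m i = 1\<close> and hence \<open>qt i = 1\<close>. Scalars and powers of
  h_w(i) go into p_i, so that b_i = 1 and a zero exponent of h_w(i) in row i of t are possible; this
  also makes (ii) trivial for i = l.\<close>

abbreviation "single \<equiv> Poly_Mapping.single"
abbreviation "coeff \<equiv> Poly_Mapping.lookup"
abbreviation "keys \<equiv> Poly_Mapping.keys"

declare upt_Suc [simp del] One_nat_def [simp del]

section \<open>Twisted group algebras of ordered groups\<close>

text \<open>Products, substitutions and normal forms are all built this way, so that an identity
  between them reduces by additivity to single terms.\<close>

definition pm_extend :: "('a \<Rightarrow> 'b::zero \<Rightarrow> 'c::comm_monoid_add) \<Rightarrow> ('a \<Rightarrow>\<^sub>0 'b) \<Rightarrow> 'c" where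
  "pm_extend T f = (\<Sum>a\<in>keys f. T a (coeff f a))"

lemma pm_extend_superset:
  assumes "finite S" "keys f \<subseteq> S" "\<And>a. T a 0 = 0"
  shows "pm_extend T f = (\<Sum>a\<in>S. T a (coeff f a))"
  unfolding pm_extend_def
  by (rule sum.mono_neutral_left) (use assms in \<open>auto simp: in_keys_iff\<close>)

lemma pm_extend_add:
  assumes "\<And>a. T a 0 = 0" "\<And>a x y. T a (x + y) = T a x + T a y"
  shows "pm_extend T (f + g) = pm_extend T f + pm_extend T g"
proof -
  let ?S = "keys f \<union> keys g"
  have "pm_extend T h = (\<Sum>a\<in>?S. T a (coeff h a))" if "keys h \<subseteq> ?S" for h
    by (rule pm_extend_superset) (use that assms in auto)
  moreover have "keys (f + g) \<subseteq> ?S" by (rule Poly_Mapping.keys_add)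
  ultimately show ?thesis
    by (simp add: lookup_add assms(2) sum.distrib)
qed

lemma pm_extend_zero [simp]: "pm_extend T 0 = 0"
  by (simp add: pm_extend_def)

lemma pm_extend_single: "T a 0 = 0 \<Longrightarrow> pm_extend T (single a x) = T a x"
  by (auto simp: pm_extend_def)

lemma pm_induct [case_names zero single add]:
  assumes "P 0" and "\<And>a x. P (single a x)" and "\<And>f g. P f \<Longrightarrow> P g \<Longrightarrow> P (f + g)"
  shows "P (f :: 'a \<Rightarrow>\<^sub>0 'b::comm_monoid_add)"
proof -
  have P_sum: "finite S \<Longrightarrow> P (\<Sum>a\<in>S. single a (h a))" for S and h :: "'a \<Rightarrow> 'b"
    by (induction S rule: finite_induct) (auto intro: assms)
  have "f = (\<Sum>a\<in>keys f. single a (coeff f a))"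
    by (rule poly_mapping_eqI) (auto simp: lookup_sum lookup_single when_def in_keys_iff)
  then show ?thesis using P_sum[of "keys f" "coeff f"] by simp
qed

text \<open>Two instances matter: a twist keeps the exponent and rescales by a character, and an
  evaluation of one variable erases a coordinate and multiplies by a power of the value.\<close>

definition mono_hom :: "('a \<Rightarrow> 'b) \<Rightarrow> ('a \<Rightarrow> 'k) \<Rightarrow> ('a \<Rightarrow>\<^sub>0 'k) \<Rightarrow> ('b \<Rightarrow>\<^sub>0 'k::comm_ring_1)" where
  "mono_hom \<theta> \<chi> = pm_extend (\<lambda>a c. single (\<theta> a) (\<chi> a * c))"

lemma mono_hom_zero [simp]: "mono_hom \<theta> \<chi> 0 = 0"
  by (simp add: mono_hom_def)

lemma mono_hom_add: "mono_hom \<theta> \<chi> (f + g) = mono_hom \<theta> \<chi> f + mono_hom \<theta> \<chi> g"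
  unfolding mono_hom_def by (rule pm_extend_add) (auto simp: single_add distrib_left)

lemma mono_hom_diff: "mono_hom \<theta> \<chi> (f - g) = mono_hom \<theta> \<chi> f - mono_hom \<theta> \<chi> g"
  by (metis add_diff_cancel_right' diff_add_cancel mono_hom_add)

lemma mono_hom_single: "mono_hom \<theta> \<chi> (single a c) = single (\<theta> a) (\<chi> a * c)"
  unfolding mono_hom_def by (subst pm_extend_single) auto

lemma mono_hom_mult:
  fixes f g :: "'a::comm_monoid_add \<Rightarrow>\<^sub>0 'k::comm_ring_1" and \<theta> :: "'a \<Rightarrow> 'b::comm_monoid_add"
  assumes "\<And>a b. \<theta> (a + b) = \<theta> a + \<theta> b" "\<And>a b. \<chi> (a + b) = \<chi> a * \<chi> b"
  shows "mono_hom \<theta> \<chi> (f * g) = mono_hom \<theta> \<chi> f * mono_hom \<theta> \<chi> g"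
proof (induction f rule: pm_induct)
  case (single a x)
  show ?case
    by (induction g rule: pm_induct)
      (auto simp: mult_single mono_hom_single assms mono_hom_add distrib_left mult_ac(1) mult.left_commute)
qed (auto simp: mono_hom_add distrib_right)

text \<open>The product of a skew group ring: with X^\<alpha> a formal monomial, (a X^\<alpha>)(b
  X^\<beta>) = a s_\<alpha>(b) X^(\<alpha>+\<beta>).\<close>

definition twisted_mult :: "('g \<Rightarrow> 'r \<Rightarrow> 'r) \<Rightarrow> ('g \<Rightarrow>\<^sub>0 'r) \<Rightarrow> ('g \<Rightarrow>\<^sub>0 'r) \<Rightarrow> ('g::monoid_add \<Rightarrow>\<^sub>0 'r::comm_ring_1)" where
  "twisted_mult s F G = pm_extend (\<lambda>\<alpha> a. pm_extend (\<lambda>\<beta> b. single (\<alpha> + \<beta>) (a * s \<alpha> b)) G) F"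

locale additive_twist =
  fixes s :: "'g::monoid_add \<Rightarrow> 'r::comm_ring_1 \<Rightarrow> 'r"
  assumes s_add: "s \<alpha> (x + y) = s \<alpha> x + s \<alpha> y"
begin

lemma s_zero [simp]: "s \<alpha> 0 = 0"
  using s_add[of \<alpha> 0 0] by simp

lemma twisted_mult_add_right: "twisted_mult s F (G + H) = twisted_mult s F G + twisted_mult s F H"
proof -
  have "pm_extend (\<lambda>\<beta> b. single (\<alpha> + \<beta>) (a * s \<alpha> b)) (G + H) =
      pm_extend (\<lambda>\<beta> b. single (\<alpha> + \<beta>) (a * s \<alpha> b)) G + 
      pm_extend (\<lambda>\<beta> b. single (\<alpha> + \<beta>) (a * s \<alpha> b)) H" for \<alpha> a
    by (rule pm_extend_add) (auto simp: s_add distrib_left single_add)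
  then show ?thesis by (simp add: twisted_mult_def pm_extend_def sum.distrib)
qed

lemma twisted_mult_add_left: "twisted_mult s (F + G) H = twisted_mult s F H + twisted_mult s G H"
  unfolding twisted_mult_def
  by (rule pm_extend_add) (auto simp: pm_extend_def distrib_right single_add sum.distrib)

lemma twisted_mult_single:
  "twisted_mult s (single \<alpha> a) (single \<beta> b) = single (\<alpha> + \<beta>) (a * s \<alpha> b)"
  unfolding twisted_mult_def by (subst pm_extend_single, simp add: pm_extend_def, subst pm_extend_single) auto

lemma twisted_mult_zero [simp]: "twisted_mult s 0 F = 0" "twisted_mult s F 0 = 0"
  by (simp_all add: twisted_mult_def pm_extend_def)

lemma twisted_mult_sum_left: "twisted_mult s (\<Sum>x\<in>S. f x) G = (\<Sum>x\<in>S. twisted_mult s (f x) G)"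
  by (induction S rule: infinite_finite_induct) (auto simp: twisted_mult_add_left)

lemma twisted_mult_sum_right: "twisted_mult s F (\<Sum>x\<in>S. g x) = (\<Sum>x\<in>S. twisted_mult s F (g x))"
  by (induction S rule: infinite_finite_induct) (auto simp: twisted_mult_add_right)

end

lemma pm_single_if_unique_key:
  assumes "\<And>a. a \<in> keys F \<Longrightarrow> a = a0"
  shows "F = single a0 (coeff F a0)"
proof (rule poly_mapping_eqI)
  fix k show "coeff F k = coeff (single a0 (coeff F a0)) k"
    using assms[of k] by (cases "k \<in> keys F") (auto simp: lookup_single when_def in_keys_iff)
qed

text \<open>The products of the two largest and of the two smallest terms cannot cancel.\<close>

lemma twisted_mult_eq_single:
  fixes F G :: "'g::linordered_ab_group_add \<Rightarrow>\<^sub>0 'r::idom"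
  assumes s_add: "\<And>\<alpha> x y. s \<alpha> (x + y) = s \<alpha> x + s \<alpha> y"
    and s_inj: "\<And>\<alpha> x. s \<alpha> x = 0 \<Longrightarrow> x = 0"
    and prod: "twisted_mult s F G = single \<gamma> c" and "c \<noteq> 0"
  obtains \<alpha> a \<beta> b where "F = single \<alpha> a" "G = single \<beta> b" "\<alpha> + \<beta> = \<gamma>" "a * s \<alpha> b = c"
proof -
  interpret additive_twist s by unfold_locales (rule s_add)
  let ?K = "keys F" and ?L = "keys G"
  have nz: "F \<noteq> 0" "G \<noteq> 0"
    using prod \<open>c \<noteq> 0\<close> by (metis twisted_mult_zero lookup_single_eq lookup_zero)+
  then have ne: "?K \<noteq> {}" "?L \<noteq> {}" by auto
  \<comment> \<open>A pair of keys that is determined by its sum contributes the whole coefficient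
    at that sum. This coefficient is nonzero, so the sum must be the only key of the
    product.\<close>
  have key: "\<alpha>0 + \<beta>0 = \<gamma>"
    if in_keys: "\<alpha>0 \<in> ?K" "\<beta>0 \<in> ?L" and uniq: "\<And>\<alpha> \<beta>. \<lbrakk>\<alpha> \<in> ?K; \<beta> \<in> ?L; \<alpha> + \<beta> = \<alpha>0 + \<beta>0\<rbrakk> \<Longrightarrow> \<alpha> = \<alpha>0 \<and> \<beta> = \<beta>0"
    for \<alpha>0 \<beta>0
  proof -
    let ?t = "\<lambda>\<alpha> \<beta>. coeff F \<alpha> * s \<alpha> (coeff G \<beta>)"
    have "coeff (twisted_mult s F G) (\<alpha>0 + \<beta>0) = (\<Sum>\<alpha>\<in>?K. \<Sum>\<beta>\<in>?L. (?t \<alpha> \<beta> when \<alpha> + \<beta> = \<alpha>0 + \<beta>0))"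
      by (simp add: twisted_mult_def pm_extend_def lookup_sum lookup_single)
    also have "\<dots> = (\<Sum>\<alpha>\<in>?K. \<Sum>\<beta>\<in>?L. if \<beta> = \<beta>0 then if \<alpha> = \<alpha>0 then ?t \<alpha> \<beta> else 0 else 0)"
      by (intro sum.cong refl) (use uniq in \<open>auto simp: when_def\<close>)
    also have "\<dots> = ?t \<alpha>0 \<beta>0" using in_keys by simp
    finally have "coeff (twisted_mult s F G) (\<alpha>0 + \<beta>0) \<noteq> 0"
      using in_keys s_inj by (auto simp: in_keys_iff)
    then show ?thesis by (simp add: prod lookup_single when_def split: if_splits)
  qed
  have max: "Max ?K + Max ?L = \<gamma>"
  proof (rule key)
    fix \<alpha> \<beta> assume "\<alpha> \<in> ?K" "\<beta> \<in> ?L" "\<alpha> + \<beta> = Max ?K + Max ?L"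
    moreover have "\<alpha> \<le> Max ?K" "\<beta> \<le> Max ?L" using calculation by auto
    ultimately show "\<alpha> = Max ?K \<and> \<beta> = Max ?L" by (metis add_le_less_mono add_less_le_mono order.order_iff_strict less_irrefl)
  qed (use ne in auto)
  have min: "Min ?K + Min ?L = \<gamma>"
  proof (rule key)
    fix \<alpha> \<beta> assume "\<alpha> \<in> ?K" "\<beta> \<in> ?L" "\<alpha> + \<beta> = Min ?K + Min ?L"
    moreover have "Min ?K \<le> \<alpha>" "Min ?L \<le> \<beta>" using calculation by auto
    ultimately show "\<alpha> = Min ?K \<and> \<beta> = Min ?L" by (metis add_le_less_mono add_less_le_mono order.order_iff_strict less_irrefl)
  qed (use ne in auto)
  \<comment> \<open>The sum of the two minima equals the sum of the two maxima, so each support has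
    minimum equal to maximum and is a single point.\<close>
  have le: "Min ?K \<le> Max ?K" "Min ?L \<le> Max ?L" using ne by simp_all
  then have eq: "Min ?K = Max ?K" "Min ?L = Max ?L"
    using max min by (metis add_le_less_mono add_less_le_mono order.order_iff_strict less_irrefl)+
  have "a = Max ?K" if "a \<in> ?K" for a using that eq(1) by (metis Max_ge Min_le finite_keys order_antisym)
  then have F: "F = single (Max ?K) (coeff F (Max ?K))" by (rule pm_single_if_unique_key)
  have "a = Max ?L" if "a \<in> ?L" for a using that eq(2) by (metis Max_ge Min_le finite_keys order_antisym)
  then have G: "G = single (Max ?L) (coeff G (Max ?L))" by (rule pm_single_if_unique_key)
  have "single (Max ?K + Max ?L) (coeff F (Max ?K) * s (Max ?K) (coeff G (Max ?L))) = single \<gamma> c"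
    using prod twisted_mult_single F G by metis
  then have "coeff F (Max ?K) * s (Max ?K) (coeff G (Max ?L)) = c"
    unfolding max by (metis lookup_single_eq)
  with F G max show thesis by (rule that)
qed

text \<open>Lets the result on skew products be applied to ordinary Laurent polynomials as
  well.\<close>

lemma twisted_mult_trivial: "twisted_mult (\<lambda>_ x. x) F G = F * G"
proof -
  interpret additive_twist "\<lambda>_ x. x" by unfold_locales simp
  show ?thesis
  proof (induction F rule: pm_induct)
    case (single a x)
    show ?case by (induction G rule: pm_induct) (auto simp: twisted_mult_single mult_single twisted_mult_add_right distrib_left)
  qed (auto simp: twisted_mult_add_left distrib_right)
qed

lemma mult_eq_single:
  fixes F G :: "'g::linordered_ab_group_add \<Rightarrow>\<^sub>0 'r::idom"
  assumes "F * G = single \<gamma> c" and "c \<noteq> 0"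
  obtains \<alpha> a \<beta> b where "F = single \<alpha> a" "G = single \<beta> b" "\<alpha> + \<beta> = \<gamma>" "a * b = c"
  using twisted_mult_eq_single[of "\<lambda>_ x. x" F G \<gamma> c] assms by (metis twisted_mult_trivial)

text \<open>Grading the group algebra by \<open>\<theta>\<close> embeds it into \<open>'h \<Rightarrow>\<^sub>0 ('g \<Rightarrow>\<^sub>0 'r)\<close>.\<close>

lemma factors_homogeneous:
  fixes f g :: "'g::linordered_ab_group_add \<Rightarrow>\<^sub>0 'r::idom" and \<theta> :: "'g \<Rightarrow> 'h::linordered_ab_group_add"
  assumes \<theta>: "\<And>a b. \<theta> (a + b) = \<theta> a + \<theta> b"
    and hom: "\<And>\<alpha>. \<alpha> \<in> keys (f * g) \<Longrightarrow> \<theta> \<alpha> = \<gamma>" and "f * g \<noteq> 0"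
  obtains \<alpha> \<beta> where "\<alpha> + \<beta> = \<gamma>" "\<And>a. a \<in> keys f \<Longrightarrow> \<theta> a = \<alpha>" "\<And>a. a \<in> keys g \<Longrightarrow> \<theta> a = \<beta>"
proof -
  define E :: "('g \<Rightarrow>\<^sub>0 'r) \<Rightarrow> ('h \<Rightarrow>\<^sub>0 ('g \<Rightarrow>\<^sub>0 'r))" where
    "E = pm_extend (\<lambda>a c. single (\<theta> a) (single a c))"
  have E_single: "E (single a c) = single (\<theta> a) (single a c)" for a c
    unfolding E_def by (subst pm_extend_single) auto
  have E_add: "E (u + v) = E u + E v" for u v
    unfolding E_def by (rule pm_extend_add) (auto simp: single_add)
  have E_zero: "E 0 = 0" by (simp add: E_def)
  have E_mult: "E (u * v) = E u * E v" for u v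
  proof (induction u rule: pm_induct)
    case (single a x)
    show ?case by (induction v rule: pm_induct) (auto simp: mult_single E_single \<theta> E_add E_zero distrib_left)
  qed (auto simp: E_add E_zero distrib_right)
  have E_lookup: "coeff (coeff (E u) \<beta>) a = (coeff u a when \<theta> a = \<beta>)" for u \<beta> a
    by (induction u rule: pm_induct) (auto simp: E_zero E_single E_add lookup_add lookup_single when_def)
  have "E (f * g) = single \<gamma> (f * g)"
  proof (intro poly_mapping_eqI)
    fix \<beta> a show "coeff (coeff (E (f * g)) \<beta>) a = coeff (coeff (single \<gamma> (f * g)) \<beta>) a"
      using hom[of a] by (cases "a \<in> keys (f * g)") (auto simp: E_lookup lookup_single when_def in_keys_iff)
  qed
  then have "E f * E g = single \<gamma> (f * g)" by (simp add: E_mult)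
  \<comment> \<open>The coefficients are now elements of the group algebra itself, which is an
    integral domain, so the one-term result applies with the whole product as the
    coefficient.\<close>
  then obtain \<alpha> a \<beta> b where *: "E f = single \<alpha> a" "E g = single \<beta> b" "\<alpha> + \<beta> = \<gamma>"
    using mult_eq_single \<open>f * g \<noteq> 0\<close> by metis
  have E_keys: "\<theta> x = \<delta>" if "E u = single \<delta> e" "x \<in> keys u" for u \<delta> e x
    using E_lookup[of u "\<theta> x" x] that by (auto simp: in_keys_iff lookup_single when_def split: if_splits)
  show thesis by (rule that[OF *(3)]) (use E_keys * in blast)+
qed

section \<open>The free algebra and the defining ideal\<close>

text \<open>The induction methods eta-expand variables of function type, and these rules would then
  rewrite \<open>f + g\<close> to \<open>\<lambda>x. f x + g x\<close>.\<close>

declare plus_fun_apply [simp del] zero_fun_apply [simp del] minus_apply [simp del]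

lemmas fun_apply = plus_fun_apply zero_fun_apply minus_apply

text \<open>The pointwise group structure gives access to finite sums and group simplification.
  Multiplication stays \<open>fa_mult\<close>, because pointwise \<open>*\<close> is a different
  product.\<close>

lemma fa_add_eq: "fa_add f g = f + g"
  for f g :: "'k::field fa"
  by (simp add: fa_add_def fun_eq_iff fun_apply)

lemma fa_diff_eq: "fa_diff f g = f - g"
  for f g :: "'k::field fa"
  by (simp add: fa_diff_def fun_eq_iff fun_apply)

lemma fa_zero_eq: "fa_zero = 0"
  by (simp add: fa_zero_def fun_eq_iff fun_apply)

lemma sum_fun_apply: "(\<Sum>x\<in>S. f x) w = (\<Sum>x\<in>S. (f x w :: 'b::comm_monoid_add))"
  using sum_comp_morphism[of "\<lambda>g. g w" f S] by (simp add: fun_apply comp_def)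

lemma sum_closed:
  assumes "P 0" "\<And>a b. P a \<Longrightarrow> P b \<Longrightarrow> P (a + b)" "\<And>x. x \<in> S \<Longrightarrow> P (f x)"
  shows "P (sum f S)"
  using assms(3) by (induction S rule: infinite_finite_induct) (simp_all add: assms(1,2))

definition fa_word :: "gen list \<Rightarrow> 'k::field fa" where
  "fa_word w = (\<lambda>u. if u = w then 1 else 0)"

lemma fa_one_eq: "fa_one = fa_word []"
  by (simp add: fa_one_def fa_word_def)

lemma fa_gen_eq: "fa_gen g = fa_word [g]"
  by (simp add: fa_gen_def fa_word_def)

lemma fa_mult_add_left: "fa_mult (f + g) h = fa_mult f h + fa_mult g h"
  for f g h :: "'k::field fa"
  by (simp add: fa_mult_def fun_eq_iff fun_apply distrib_right sum.distrib)

lemma fa_mult_add_right: "fa_mult f (g + h) = fa_mult f g + fa_mult f h"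
  for f g h :: "'k::field fa"
  by (simp add: fa_mult_def fun_eq_iff fun_apply distrib_left sum.distrib)

lemma fa_mult_diff_left: "fa_mult (f - g) h = fa_mult f h - fa_mult g h"
  for f g h :: "'k::field fa"
  by (simp add: fa_mult_def fun_eq_iff fun_apply left_diff_distrib sum_subtractf)

lemma fa_mult_diff_right: "fa_mult f (g - h) = fa_mult f g - fa_mult f h"
  for f g h :: "'k::field fa"
  by (simp add: fa_mult_def fun_eq_iff fun_apply right_diff_distrib sum_subtractf)

lemma fa_mult_scal_left: "fa_mult (fa_scal c f) g = fa_scal c (fa_mult f g)"
  for f g :: "'k::field fa"
  by (simp add: fa_mult_def fa_scal_def fun_eq_iff fun_apply sum_distrib_left mult.assoc)

lemma fa_mult_scal_right: "fa_mult f (fa_scal c g) = fa_scal c (fa_mult f g)"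
  for f g :: "'k::field fa"
  by (simp add: fa_mult_def fa_scal_def fun_eq_iff fun_apply sum_distrib_left mult.left_commute)

lemma fa_mult_zero [simp]: "fa_mult 0 f = 0" "fa_mult f 0 = 0"
  for f :: "'k::field fa"
  by (simp_all add: fa_mult_def fun_eq_iff fun_apply)

lemma fa_mult_sum_left: "fa_mult (\<Sum>x\<in>S. f x) g = (\<Sum>x\<in>S. fa_mult (f x) g)"
  for g :: "'k::field fa" and f :: "'b \<Rightarrow> 'k::field fa"
  using sum_comp_morphism[of "\<lambda>u. fa_mult u g" f S] by (simp add: fa_mult_add_left comp_def)

lemma fa_mult_sum_right: "fa_mult f (\<Sum>x\<in>S. g x) = (\<Sum>x\<in>S. fa_mult f (g x))"
  for f :: "'k::field fa" and g :: "'b \<Rightarrow> 'k::field fa"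
  using sum_comp_morphism[of "fa_mult f" g S] by (simp add: fa_mult_add_right comp_def)

lemma fa_scal_add: "fa_scal c (f + g) = fa_scal c f + fa_scal c g"
  for f g :: "'k::field fa"
  by (simp add: fa_scal_def fun_eq_iff fun_apply distrib_left)

lemma fa_scal_diff: "fa_scal c (f - g) = fa_scal c f - fa_scal c g"
  for f g :: "'k::field fa"
  by (simp add: fa_scal_def fun_eq_iff fun_apply right_diff_distrib)

lemma fa_scal_sum: "fa_scal c (\<Sum>x\<in>S. f x) = (\<Sum>x\<in>S. fa_scal c (f x))"
  for f :: "'b \<Rightarrow> 'k::field fa"
  by (simp add: fa_scal_def fun_eq_iff fun_apply sum_fun_apply sum_distrib_left)

lemma fa_scal_scal: "fa_scal a (fa_scal b f) = fa_scal (a * b) f"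
  for f :: "'k::field fa"
  by (simp add: fa_scal_def mult.assoc)

lemma fa_scal_1 [simp]: "fa_scal 1 f = f" and fa_scal_0 [simp]: "fa_scal 0 f = 0" "fa_scal c 0 = 0"
  for f :: "'k::field fa"
  by (simp_all add: fa_scal_def fun_eq_iff fun_apply)

lemma fa_scal_add_left: "fa_scal (a + b) f = fa_scal a f + fa_scal b f"
  for f :: "'k::field fa"
  by (simp add: fa_scal_def fun_eq_iff fun_apply distrib_right)

text \<open>At a word both sides sum over the ways to cut it into three pieces: by the later cut i
  and then the earlier cut j on the left, by j and the length k = i - j of the middle piece on the
  right.\<close>

lemma fa_mult_assoc: "fa_mult (fa_mult f g) h = fa_mult f (fa_mult g h)"
  for f g h :: "'k::field fa"
proof
  fix w :: "gen list"
  let ?n = "length w"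
  let ?t = "\<lambda>j i. f (take j w) * g (take (i - j) (drop j w)) * h (drop i w)"
  have "fa_mult (fa_mult f g) h w = (\<Sum>i\<le>?n. \<Sum>j\<le>i. ?t j i)"
    unfolding fa_mult_def
  proof (rule sum.cong[OF refl])
    fix i assume i: "i \<in> {..?n}"
    then have "(\<Sum>j\<le>length (take i w). f (take j (take i w)) * g (drop j (take i w))) * h (drop i w)
        = (\<Sum>j\<le>i. f (take j (take i w)) * g (drop j (take i w)) * h (drop i w))"
      by (simp add: min_absorb2 sum_distrib_right)
    also have "\<dots> = (\<Sum>j\<le>i. ?t j i)"
      by (rule sum.cong[OF refl]) (simp add: min_absorb1 drop_take)
    finally show "(\<Sum>j\<le>length (take i w). f (take j (take i w)) * g (drop j (take i w))) * h (drop i w)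
        = (\<Sum>j\<le>i. ?t j i)" .
  qed
  also have "\<dots> = (\<Sum>(i, j)\<in>Sigma {..?n} (\<lambda>i. {..i}). ?t j i)"
    by (simp add: sum.Sigma)
  also have "\<dots> = (\<Sum>(j, k)\<in>Sigma {..?n} (\<lambda>j. {..?n - j}). ?t j (j + k))"
    by (rule sum.reindex_bij_witness[of _ "\<lambda>(j, k). (j + k, j)" "\<lambda>(i, j). (j, i - j)"]) auto
  also have "\<dots> = (\<Sum>j\<le>?n. \<Sum>k\<le>?n - j. ?t j (j + k))"
    by (simp add: sum.Sigma)
  also have "\<dots> = fa_mult f (fa_mult g h) w"
    unfolding fa_mult_def
  proof (rule sum.cong[OF refl])
    fix j
    show "(\<Sum>k\<le>?n - j. ?t j (j + k)) = f (take j w) *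
        (\<Sum>k\<le>length (drop j w). g (take k (drop j w)) * h (drop k (drop j w)))"
      by (simp add: sum_distrib_left mult.assoc add.commute)
  qed
  finally show "fa_mult (fa_mult f g) h w = fa_mult f (fa_mult g h) w" .
qed

lemma fa_word_mult: "fa_mult (fa_word u) (fa_word v) = (fa_word (u @ v) :: 'k::field fa)"
proof
  fix w :: "gen list"
  have "fa_mult (fa_word u) (fa_word v) w = (\<Sum>i\<le>length w. if i = length u then (if w = u @ v then 1 else 0) else 0 :: 'k)"
    unfolding fa_mult_def fa_word_def
  proof (rule sum.cong[OF refl])
    fix i assume "i \<in> {..length w}"
    then have "take i w = u \<and> drop i w = v \<longleftrightarrow> i = length u \<and> w = u @ v"
      by (auto simp: min_absorb2)
    moreover have "(if take i w = u then 1 else 0) * (if drop i w = v then 1 else 0) =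
        (if take i w = u \<and> drop i w = v then 1 else 0 :: 'k)"
      by simp
    ultimately have "(if take i w = u then 1 else 0) * (if drop i w = v then 1 else 0) =
        (if i = length u \<and> w = u @ v then 1 else 0 :: 'k)"
      by (simp only:)
    also have "\<dots> = (if i = length u then if w = u @ v then 1 else 0 else 0)"
      by simp
    finally show "(if take i w = u then 1 else 0) * (if drop i w = v then 1 else 0) =
        (if i = length u then if w = u @ v then 1 else 0 else 0 :: 'k)" .
  qed
  then show "fa_mult (fa_word u) (fa_word v) w = (fa_word (u @ v) w :: 'k)"
    by (auto simp: fa_word_def[of "u @ v"])
qed

lemma fa_one_mult [simp]: "fa_mult fa_one f = f"
  for f :: "'k::field fa"
proof
  fix w
  have "fa_mult fa_one f w = (\<Sum>i\<le>length w. if i = 0 then f w else 0)"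
    unfolding fa_mult_def fa_one_def by (intro sum.cong refl) auto
  then show "fa_mult fa_one f w = f w" by simp
qed

lemma fa_mult_one [simp]: "fa_mult f fa_one = f"
  for f :: "'k::field fa"
proof
  fix w
  have "fa_mult f fa_one w = (\<Sum>i\<le>length w. if i = length w then f w else 0)"
    unfolding fa_mult_def fa_one_def by (intro sum.cong refl) auto
  then show "fa_mult f fa_one w = f w" by simp
qed

lemma fa_pow_word: "fa_pow (fa_word [g]) k = fa_word (replicate k g)"
  by (induction k) (simp_all add: fa_one_eq fa_word_mult)

definition over :: "nat \<Rightarrow> gen list \<Rightarrow> bool" where
  "over n w \<longleftrightarrow> (\<forall>g\<in>set w. gidx g \<in> {1..n})"

lemma over_simps [simp]:
  "over n []" "over n (g # w) \<longleftrightarrow> gidx g \<in> {1..n} \<and> over n w" "over n (u @ v) \<longleftrightarrow> over n u \<and> over n v"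
  by (auto simp: over_def)

lemma over_replicate: "gidx g \<in> {1..n} \<Longrightarrow> over n (replicate k g)"
  by (auto simp: over_def)

lemma fa_expand:
  fixes f :: "'k::field fa"
  assumes "finite S" "{w. f w \<noteq> 0} \<subseteq> S"
  shows "f = (\<Sum>w\<in>S. fa_scal (f w) (fa_word w))"
proof
  fix u
  have "(\<Sum>w\<in>S. fa_scal (f w) (fa_word w)) u = (\<Sum>w\<in>S. if u = w then f u else 0)"
    unfolding sum_fun_apply by (intro sum.cong refl) (simp add: fa_scal_def fa_word_def)
  then show "f u = (\<Sum>w\<in>S. fa_scal (f w) (fa_word w)) u" using assms by auto
qed

lemma free_algD:
  assumes "f \<in> free_alg n"
  shows "finite {w. f w \<noteq> 0}" "f w \<noteq> 0 \<Longrightarrow> over n w"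
  using assms by (auto simp: free_alg_def over_def)

lemma fa_word_free_alg: "over n w \<Longrightarrow> fa_word w \<in> free_alg n"
  by (auto simp: free_alg_def fa_word_def over_def)

lemma fa_scal_free_alg: "f \<in> free_alg n \<Longrightarrow> fa_scal c f \<in> free_alg n"
  for f :: "'k::field fa"
  by (auto simp: free_alg_def fa_scal_def)

lemma fa_zero_free_alg: "0 \<in> free_alg n"
  by (auto simp: free_alg_def fun_apply)

lemma fa_add_free_alg: "f \<in> free_alg n \<Longrightarrow> g \<in> free_alg n \<Longrightarrow> f + g \<in> free_alg n"
  for f g :: "'k::field fa"
  unfolding free_alg_def fun_apply mem_Collect_eq
proof (intro conjI allI impI)
  assume "finite {w. f w \<noteq> 0} \<and> (\<forall>w. f w \<noteq> 0 \<longrightarrow> (\<forall>g\<in>set w. gidx g \<in> {1..n}))"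
    "finite {w. g w \<noteq> 0} \<and> (\<forall>w. g w \<noteq> 0 \<longrightarrow> (\<forall>g\<in>set w. gidx g \<in> {1..n}))"
  then have "finite ({w. f w \<noteq> 0} \<union> {w. g w \<noteq> 0})" by simp
  then show "finite {w. f w + g w \<noteq> 0}" by (rule rev_finite_subset) auto
qed (metis add_0)

lemma fa_diff_free_alg: "f \<in> free_alg n \<Longrightarrow> g \<in> free_alg n \<Longrightarrow> f - g \<in> free_alg n"
  for f g :: "'k::field fa"
proof -
  have "f - g = f + fa_scal (-1) g" by (simp add: fa_scal_def fun_eq_iff fun_apply)
  then show "f \<in> free_alg n \<Longrightarrow> g \<in> free_alg n \<Longrightarrow> f - g \<in> free_alg n"
    by (metis fa_add_free_alg fa_scal_free_alg)
qed

lemma fa_sum_free_alg: "(\<And>x. x \<in> S \<Longrightarrow> f x \<in> free_alg n) \<Longrightarrow> (\<Sum>x\<in>S. f x) \<in> free_alg n"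
  for f :: "'b \<Rightarrow> 'k::field fa"
  by (rule sum_closed[where P = "\<lambda>g. g \<in> free_alg n"]) (simp_all add: fa_zero_free_alg fa_add_free_alg)

lemma free_alg_induct [consumes 1, case_names zero word add]:
  fixes f :: "'k::field fa"
  assumes "f \<in> free_alg n" and "P 0" and "\<And>c w. over n w \<Longrightarrow> P (fa_scal c (fa_word w))"
    and "\<And>f g. f \<in> free_alg n \<Longrightarrow> g \<in> free_alg n \<Longrightarrow> P f \<Longrightarrow> P g \<Longrightarrow> P (f + g)"
  shows "P f"
proof -
  let ?S = "{w. f w \<noteq> 0}"
  have "P (\<Sum>w\<in>?S. fa_scal (f w) (fa_word w)) \<and> (\<Sum>w\<in>?S. fa_scal (f w) (fa_word w)) \<in> free_alg n"
  proof (rule sum_closed[where P = "\<lambda>g. P g \<and> g \<in> free_alg n"])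
    fix w assume "w \<in> ?S"
    then have "over n w" using free_algD(2)[OF assms(1)] by blast
    then show "P (fa_scal (f w) (fa_word w)) \<and> fa_scal (f w) (fa_word w) \<in> free_alg n"
      using assms(3) fa_scal_free_alg fa_word_free_alg by blast
  next
    show "P 0 \<and> 0 \<in> free_alg n" using assms(2) fa_zero_free_alg by blast
  next
    fix g h assume "P g \<and> g \<in> free_alg n" "P h \<and> h \<in> free_alg n"
    then show "P (g + h) \<and> g + h \<in> free_alg n" using assms(4) fa_add_free_alg by blast
  qed
  moreover have "f = (\<Sum>w\<in>?S. fa_scal (f w) (fa_word w))"
    by (rule fa_expand) (use free_algD(1)[OF assms(1)] in simp_all)
  ultimately show ?thesis by metis
qed

lemma fa_mult_free_alg: "f \<in> free_alg n \<Longrightarrow> g \<in> free_alg n \<Longrightarrow> fa_mult f g \<in> free_alg n"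
  for f g :: "'k::field fa"
proof (induction f rule: free_alg_induct)
  case (word c w)
  from word(2,1) show ?case
    by (induction g rule: free_alg_induct)
      (auto simp: fa_zero_free_alg fa_mult_add_right fa_mult_scal_left fa_mult_scal_right fa_word_mult
        intro!: fa_add_free_alg fa_scal_free_alg fa_word_free_alg)
qed (auto simp: fa_zero_free_alg fa_mult_add_left intro: fa_add_free_alg)

text \<open>The inductive definition closes only under sums; a scalar, and in the next two lemmas an
  outer factor, is absorbed into the cofactors u and v of a generator.\<close>

lemma rel_ideal_scal: "f \<in> rel_ideal n d q \<Longrightarrow> fa_scal c f \<in> rel_ideal n d q"
  for f :: "'k::field fa"
proof (induction rule: rel_ideal.induct)
  case (gen r u v)
  then show ?case using rel_ideal.gen[of r n d q "fa_scal c u" v] by (simp add: fa_mult_scal_left fa_scal_free_alg)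
next
  case zero
  then show ?case using rel_ideal.zero[of n d q] by (simp add: fa_zero_eq)
qed (auto simp: fa_add_eq fa_scal_add rel_ideal.add[unfolded fa_add_eq])

lemma rel_ideal_mult_left: "f \<in> rel_ideal n d q \<Longrightarrow> g \<in> free_alg n \<Longrightarrow> fa_mult g f \<in> rel_ideal n d q"
  for f g :: "'k::field fa"
proof (induction rule: rel_ideal.induct)
  case (gen r u v)
  then show ?case using rel_ideal.gen[of r n d q "fa_mult g u" v] by (simp add: fa_mult_assoc fa_mult_free_alg)
next
  case zero
  then show ?case using rel_ideal.zero[of n d q] by (simp add: fa_zero_eq)
qed (auto simp: fa_add_eq fa_mult_add_right rel_ideal.add[unfolded fa_add_eq])

lemma rel_ideal_mult_right: "f \<in> rel_ideal n d q \<Longrightarrow> g \<in> free_alg n \<Longrightarrow> fa_mult f g \<in> rel_ideal n d q"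
  for f g :: "'k::field fa"
proof (induction rule: rel_ideal.induct)
  case (gen r u v)
  then show ?case using rel_ideal.gen[of r n d q u "fa_mult v g"] by (simp add: fa_mult_assoc fa_mult_free_alg)
next
  case zero
  then show ?case using rel_ideal.zero[of n d q] by (simp add: fa_zero_eq)
qed (auto simp: fa_add_eq fa_mult_add_left rel_ideal.add[unfolded fa_add_eq])

lemma rels_rel_ideal: "f \<in> rels n d q \<Longrightarrow> f \<in> rel_ideal n d q"
  for f :: "'k::field fa"
  using rel_ideal.gen[of f n d q fa_one fa_one] by (metis fa_mult_one fa_one_mult fa_one_eq fa_word_free_alg over_simps(1))

lemma eqA_refl [simp]: "eqA n d q f f"
  for f :: "'k::field fa"
  using rel_ideal.zero[of n d q] by (simp add: eqA_def fa_diff_eq fa_zero_eq)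

lemma eqA_sym: "eqA n d q f g \<Longrightarrow> eqA n d q g f"
  for f g :: "'k::field fa"
proof -
  have "g - f = fa_scal (-1) (f - g)" by (simp add: fa_scal_def fun_eq_iff fun_apply)
  then show "eqA n d q f g \<Longrightarrow> eqA n d q g f" by (simp add: eqA_def fa_diff_eq rel_ideal_scal)
qed

lemma eqA_trans [trans]: "eqA n d q f g \<Longrightarrow> eqA n d q g h \<Longrightarrow> eqA n d q f h"
  for f g h :: "'k::field fa"
  using rel_ideal.add[of "f - g" n d q "g - h"] by (simp add: eqA_def fa_diff_eq fa_add_eq)

lemma eqA_add: "eqA n d q f g \<Longrightarrow> eqA n d q f' g' \<Longrightarrow> eqA n d q (f + f') (g + g')"
  for f g f' g' :: "'k::field fa"
  using rel_ideal.add[of "f - g" n d q "f' - g'"] by (simp add: eqA_def fa_diff_eq fa_add_eq algebra_simps)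

lemma eqA_scal: "eqA n d q f g \<Longrightarrow> eqA n d q (fa_scal c f) (fa_scal c g)"
  for f g :: "'k::field fa"
  by (simp add: eqA_def fa_diff_eq fa_scal_diff[symmetric] rel_ideal_scal)

lemma eqA_sum: "(\<And>x. x \<in> S \<Longrightarrow> eqA n d q (f x) (g x)) \<Longrightarrow> eqA n d q (\<Sum>x\<in>S. f x) (\<Sum>x\<in>S. g x)"
  for f g :: "'b \<Rightarrow> 'k::field fa"
  using sum_closed[where P = "\<lambda>h. h \<in> rel_ideal n d q" and f = "\<lambda>x. f x - g x" and S = S]
  by (simp add: eqA_def fa_diff_eq sum_subtractf rel_ideal.zero[unfolded fa_zero_eq] rel_ideal.add[unfolded fa_add_eq])

lemma eqA_mult_left: "eqA n d q f g \<Longrightarrow> h \<in> free_alg n \<Longrightarrow> eqA n d q (fa_mult h f) (fa_mult h g)"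
  for f g h :: "'k::field fa"
  by (simp add: eqA_def fa_diff_eq fa_mult_diff_right[symmetric] rel_ideal_mult_left)

lemma eqA_mult_right: "eqA n d q f g \<Longrightarrow> h \<in> free_alg n \<Longrightarrow> eqA n d q (fa_mult f h) (fa_mult g h)"
  for f g h :: "'k::field fa"
  by (simp add: eqA_def fa_diff_eq fa_mult_diff_left[symmetric] rel_ideal_mult_right)

lemma eqA_context:
  assumes "eqA n d q (fa_word u) f" "over n a" "over n b"
  shows "eqA n d q (fa_word (a @ u @ b)) (fa_mult (fa_word a) (fa_mult f (fa_word b)))"
  using eqA_mult_left[OF eqA_mult_right[OF assms(1)], of "fa_word b" "fa_word a"] assms(2,3)
  by (simp add: fa_word_mult fa_word_free_alg)

lemma eqA_context_scal:
  assumes "eqA n d q (fa_word u) (fa_scal c (fa_word v))" "over n a" "over n b"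
  shows "eqA n d q (fa_word (a @ u @ b)) (fa_scal c (fa_word (a @ v @ b)))"
  using eqA_context[OF assms] by (simp add: fa_word_mult fa_mult_scal_left fa_mult_scal_right)

section \<open>The quantum torus\<close>

text \<open>One type serves for exponents of h and for X-degrees. Finitely supported functions on
  all of \<open>nat\<close> form a linearly ordered group, and the Laurent polynomials over it form
  an integral domain; the restriction to the indices 1..n is imposed separately by
  \<open>expo\<close>.\<close>

type_synonym ex = "nat \<Rightarrow>\<^sub>0 int"
type_synonym 'k lau = "ex \<Rightarrow>\<^sub>0 'k"

fun gen_deg :: "gen \<Rightarrow> ex" where
  "gen_deg (GX j) = single j 1" | "gen_deg (GY j) = single j (-1)" | "gen_deg (GH j) = 0" | "gen_deg (GHi j) = 0"

primrec word_deg :: "gen list \<Rightarrow> ex" where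
  "word_deg [] = 0" | "word_deg (g # w) = gen_deg g + word_deg w"

lemma word_deg_append: "word_deg (u @ v) = word_deg u + word_deg v"
  by (induction u) (simp_all add: add.assoc)

lemma single_add_same: "single j a + single j b = single j (a + b)"
  by (simp add: single_add)

lemma binomial_nonzero: "\<alpha> \<noteq> 0 \<Longrightarrow> single \<alpha> (c::'k::field) - 1 \<noteq> 0"
  by (metis lookup_single_not_eq lookup_minus lookup_one_zero lookup_zero diff_0 neg_equal_0_iff_equal zero_neq_one)

section \<open>Evaluation of one variable of a Laurent polynomial\<close>

definition omit :: "nat \<Rightarrow> ex \<Rightarrow> ex" where
  "omit j \<alpha> = \<alpha> - single j (coeff \<alpha> j)"

lemma omit_add: "omit j (\<alpha> + \<beta>) = omit j \<alpha> + omit j \<beta>"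
  by (simp add: omit_def lookup_add single_add)

lemma lookup_omit: "coeff (omit j \<alpha>) i = (if i = j then 0 else coeff \<alpha> i)"
  by (simp add: omit_def lookup_minus lookup_single when_def)

lemma omit_zero [simp]: "omit j 0 = 0"
  by (simp add: omit_def)

lemma omit_single: "omit j (single i a) = (if i = j then 0 else single i a)"
  by (rule poly_mapping_eqI) (auto simp: lookup_omit lookup_single when_def)

lemma omit_split: "\<alpha> = omit j \<alpha> + single j (coeff \<alpha> j)"
  by (simp add: omit_def)

text \<open>The substitution of \<open>a\<close> for \<open>h\<^sub>j\<close>.\<close>

definition specialize :: "nat \<Rightarrow> 'k::field \<Rightarrow> 'k lau \<Rightarrow> 'k lau" where
  "specialize j a = mono_hom (omit j) (\<lambda>\<alpha>. a powi coeff \<alpha> j)"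

lemma specialize_mult: "a \<noteq> 0 \<Longrightarrow> specialize j a (f * g) = specialize j a f * specialize j a g"
  unfolding specialize_def by (rule mono_hom_mult) (simp_all add: omit_add lookup_add power_int_add)

lemma specialize_add: "specialize j a (f + g) = specialize j a f + specialize j a g"
  unfolding specialize_def by (rule mono_hom_add)

lemma specialize_diff: "specialize j a (f - g) = specialize j a f - specialize j a g"
  unfolding specialize_def by (rule mono_hom_diff)

lemma specialize_single: "specialize j a (single \<alpha> c) = single (omit j \<alpha>) (a powi coeff \<alpha> j * c)"
  unfolding specialize_def by (rule mono_hom_single)

lemma specialize_one [simp]: "specialize j a 1 = 1"
  using specialize_single[of j a 0 1] by simp

lemma specialize_zero [simp]: "specialize j a 0 = 0"
  unfolding specialize_def by simp

section \<open>The torus attached to one algebra; target and source are both instances\<close>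

locale gwa =
  fixes n d :: nat and q :: "nat \<Rightarrow> 'k::field"
  assumes q_nonzero: "i \<in> {1..n} \<Longrightarrow> q i \<noteq> 0" and d_pos: "d \<ge> 1"
begin

text \<open>The commutation bicharacter of the torus: X^\<beta> h^\<alpha> =
  \<open>chi \<beta> \<alpha>\<close> h^\<alpha> X^\<beta>.\<close>

definition chi :: "ex \<Rightarrow> ex \<Rightarrow> 'k" where
  "chi \<beta> \<alpha> = (\<Prod>i\<in>{1..n}. q i powi (coeff \<beta> i * coeff \<alpha> i))"

lemma chi_add_left: "chi (\<beta> + \<gamma>) \<alpha> = chi \<beta> \<alpha> * chi \<gamma> \<alpha>"
  unfolding chi_def prod.distrib[symmetric]
  by (rule prod.cong) (simp_all add: lookup_add distrib_right power_int_add q_nonzero)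

lemma chi_add_right: "chi \<beta> (\<alpha> + \<gamma>) = chi \<beta> \<alpha> * chi \<beta> \<gamma>"
  unfolding chi_def prod.distrib[symmetric]
  by (rule prod.cong) (simp_all add: lookup_add distrib_left power_int_add q_nonzero)

lemma chi_zero [simp]: "chi 0 \<alpha> = 1" "chi \<beta> 0 = 1"
  by (simp_all add: chi_def)

lemma chi_nonzero: "chi \<beta> \<alpha> \<noteq> 0"
  by (simp add: chi_def q_nonzero)

lemma chi_single_left: "j \<in> {1..n} \<Longrightarrow> chi (single j a) \<alpha> = q j powi (a * coeff \<alpha> j)"
proof -
  have "chi (single j a) \<alpha> = (\<Prod>i\<in>{1..n}. if i = j then q j powi (a * coeff \<alpha> j) else 1)"
    unfolding chi_def by (rule prod.cong) (auto simp: lookup_single when_def)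
  then show "j \<in> {1..n} \<Longrightarrow> chi (single j a) \<alpha> = q j powi (a * coeff \<alpha> j)" by simp
qed

lemma chi_single_right: "j \<in> {1..n} \<Longrightarrow> chi \<beta> (single j a) = q j powi (coeff \<beta> j * a)"
proof -
  have "chi \<beta> (single j a) = (\<Prod>i\<in>{1..n}. if i = j then q j powi (coeff \<beta> j * a) else 1)"
    unfolding chi_def by (rule prod.cong) (auto simp: lookup_single when_def)
  then show "j \<in> {1..n} \<Longrightarrow> chi \<beta> (single j a) = q j powi (coeff \<beta> j * a)" by simp
qed

text \<open>Conjugation by X^\<beta>, that is, the substitution of q_i^(\<beta>_i) h_i for every
  h_i.\<close>

definition twist :: "ex \<Rightarrow> 'k lau \<Rightarrow> 'k lau" where
  "twist \<beta> = mono_hom (\<lambda>\<alpha>. \<alpha>) (chi \<beta>)"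

lemma twist_add: "twist \<beta> (f + g) = twist \<beta> f + twist \<beta> g"
  unfolding twist_def by (rule mono_hom_add)

lemma twist_diff: "twist \<beta> (f - g) = twist \<beta> f - twist \<beta> g"
  unfolding twist_def by (rule mono_hom_diff)

lemma twist_mult: "twist \<beta> (f * g) = twist \<beta> f * twist \<beta> g"
  unfolding twist_def by (rule mono_hom_mult) (simp_all add: chi_add_right)

lemma twist_single: "twist \<beta> (single \<alpha> c) = single \<alpha> (chi \<beta> \<alpha> * c)"
  unfolding twist_def by (rule mono_hom_single)

lemma twist_one [simp]: "twist \<beta> 1 = 1"
  using twist_single[of \<beta> 0 1] by simp

lemma twist_zero [simp]: "twist \<beta> 0 = 0"
  by (simp add: twist_def)

lemma twist_twist: "twist \<beta> (twist \<gamma> f) = twist (\<beta> + \<gamma>) f"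
  by (induction f rule: pm_induct) (simp_all add: twist_add twist_single chi_add_left mult.assoc)

lemma twist_0 [simp]: "twist 0 f = f"
  by (induction f rule: pm_induct) (simp_all add: twist_add twist_single)

lemma lookup_twist: "coeff (twist \<beta> f) \<alpha> = chi \<beta> \<alpha> * coeff f \<alpha>"
  by (induction f rule: pm_induct) (auto simp: twist_add twist_single lookup_add lookup_single when_def distrib_left)

lemma twist_eq_0: "twist \<beta> f = 0 \<Longrightarrow> f = 0"
  using twist_twist[of "-\<beta>" \<beta> f] by simp

sublocale additive_twist twist
  by unfold_locales (rule twist_add)

abbreviation tmult where "tmult \<equiv> twisted_mult twist"

text \<open>Passing X^\<beta> moves the evaluation point of h_j by the factor q_j^(\<beta>_j). This
  shift is the source of the geometric progressions of roots.\<close>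

lemma specialize_twist:
  assumes "j \<in> {1..n}" "a \<noteq> 0"
  shows "specialize j a (twist \<beta> f) = twist \<beta> (specialize j (a * q j powi coeff \<beta> j) f)"
proof (induction f rule: pm_induct)
  case (single \<alpha> c)
  have "chi \<beta> \<alpha> = chi \<beta> (omit j \<alpha>) * q j powi (coeff \<beta> j * coeff \<alpha> j)"
    using assms by (subst omit_split[of \<alpha> j]) (simp add: chi_add_right chi_single_right)
  then show ?case
    by (simp add: specialize_single twist_single power_int_mult_distrib mult_ac flip: power_int_mult)
qed (simp_all add: specialize_add twist_add)

text \<open>The word \<open>w\<close> acts as \<open>word_coeff w\<close> times the monomial of exponent \<open>word_deg w\<close> in the \<open>X\<^sub>j\<close>,
  where \<open>x\<^sub>j = X\<^sub>j\<close> and \<open>y\<^sub>j = (h\<^sub>j\<^sup>d - 1) X\<^sub>j\<^sup>-\<^sup>1\<close>.\<close>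

fun gen_coeff :: "gen \<Rightarrow> 'k lau" where
  "gen_coeff (GH j) = single (single j 1) 1"
| "gen_coeff (GHi j) = single (single j (-1)) 1"
| "gen_coeff (GX j) = 1"
| "gen_coeff (GY j) = single (single j (int d)) 1 - 1"

primrec word_coeff :: "gen list \<Rightarrow> 'k lau" where
  "word_coeff [] = 1" | "word_coeff (g # w) = gen_coeff g * twist (gen_deg g) (word_coeff w)"

text \<open>Multiplicativity of the embedding on words: the degree of u twists everything to its
  right.\<close>

lemma word_coeff_append: "word_coeff (u @ v) = word_coeff u * twist (word_deg u) (word_coeff v)"
  by (induction u) (simp_all add: twist_mult twist_twist mult.assoc)

text \<open>The embedding into the torus, extended linearly from words;
  \<open>single 0 (f w)\<close> is the scalar as a constant Laurent polynomial. On a function with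
  infinite support the sum is 0 by convention, hence the \<open>free_alg\<close> hypotheses on
  additivity and multiplicativity.\<close>

definition symbol :: "'k fa \<Rightarrow> ex \<Rightarrow>\<^sub>0 'k lau" where
  "symbol f = (\<Sum>w\<in>{w. f w \<noteq> 0}. single (word_deg w) (single 0 (f w) * word_coeff w))"

lemma symbol_superset:
  assumes "finite S" "{w. f w \<noteq> 0} \<subseteq> S"
  shows "symbol f = (\<Sum>w\<in>S. single (word_deg w) (single 0 (f w) * word_coeff w))"
  unfolding symbol_def by (rule sum.mono_neutral_left) (use assms in auto)

lemma symbol_zero [simp]: "symbol 0 = 0"
  by (simp add: symbol_def fun_apply)

lemma symbol_add:
  assumes "f \<in> free_alg n" "g \<in> free_alg n"
  shows "symbol (f + g) = symbol f + symbol g"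
proof -
  let ?S = "{w. f w \<noteq> 0} \<union> {w. g w \<noteq> 0}"
  have fin: "finite ?S" using free_algD(1)[OF assms(1)] free_algD(1)[OF assms(2)] by simp
  have "{w. (f + g) w \<noteq> 0} \<subseteq> ?S" by (auto simp: fun_apply)
  then show ?thesis
    using symbol_superset[OF fin, of f] symbol_superset[OF fin, of g] symbol_superset[OF fin, of "f + g"]
    by (simp add: fun_apply single_add distrib_right sum.distrib)
qed

text \<open>Scalars act on the coefficients, while the torus product is \<open>tmult\<close>; this
  is why the relation between x and h appears coefficientwise later on.\<close>

lemma lookup_symbol_scal: "coeff (symbol (fa_scal c f)) \<beta> = single 0 c * coeff (symbol f) \<beta>"
proof (cases "c = 0")
  case False
  then have "{w. fa_scal c f w \<noteq> 0} = {w. f w \<noteq> 0}" by (simp add: fa_scal_def)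
  moreover have "single 0 (c * x) = (single 0 c * single 0 x :: 'k lau)" for x by (simp add: mult_single)
  ultimately show ?thesis
    unfolding symbol_def lookup_sum
    by (simp add: fa_scal_def sum_distrib_left lookup_single when_def mult.assoc if_distrib cong: if_cong)
qed simp

lemma symbol_word: "symbol (fa_word w) = single (word_deg w) (word_coeff w)"
  using symbol_superset[of "{w}" "fa_word w"] by (simp add: fa_word_def)

lemma symbol_scal_word: "symbol (fa_scal c (fa_word w)) = single (word_deg w) (single 0 c * word_coeff w)"
  by (rule poly_mapping_eqI) (simp add: lookup_symbol_scal symbol_word lookup_single when_def)

lemma symbol_diff:
  assumes "f \<in> free_alg n" "g \<in> free_alg n"
  shows "symbol (f - g) = symbol f - symbol g"
  using symbol_add[of "f - g" g] assms by (simp add: fa_diff_free_alg)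

lemma symbol_sum: "(\<And>x. x \<in> S \<Longrightarrow> f x \<in> free_alg n) \<Longrightarrow> symbol (\<Sum>x\<in>S. f x) = (\<Sum>x\<in>S. symbol (f x))"
proof (induction S rule: infinite_finite_induct)
  case (insert x F)
  then have "symbol (f x + sum f F) = symbol (f x) + symbol (sum f F)"
    by (intro symbol_add fa_sum_free_alg) simp_all
  with insert show ?case by simp
qed simp_all

lemma symbol_mult:
  assumes "f \<in> free_alg n" "g \<in> free_alg n"
  shows "symbol (fa_mult f g) = tmult (symbol f) (symbol g)"
proof -
  define S T where "S = {w. f w \<noteq> 0}" and "T = {w. g w \<noteq> 0}"
  have fin: "finite S" "finite T" and over: "\<And>w. w \<in> S \<Longrightarrow> over n w" "\<And>w. w \<in> T \<Longrightarrow> over n w"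
    using free_algD[OF assms(1)] free_algD[OF assms(2)] by (auto simp: S_def T_def)
  have f: "f = (\<Sum>u\<in>S. fa_scal (f u) (fa_word u))" by (rule fa_expand) (use fin in \<open>auto simp: S_def\<close>)
  have g: "g = (\<Sum>v\<in>T. fa_scal (g v) (fa_word v))" by (rule fa_expand) (use fin in \<open>auto simp: T_def\<close>)
  have "fa_mult f g = (\<Sum>u\<in>S. \<Sum>v\<in>T. fa_scal (f u * g v) (fa_word (u @ v)))"
    by (subst f, subst g, subst sum.swap)
      (simp add: fa_mult_sum_left fa_mult_sum_right fa_mult_scal_left fa_mult_scal_right fa_word_mult fa_scal_sum fa_scal_scal mult.commute)
  then have "symbol (fa_mult f g) = symbol (\<Sum>u\<in>S. \<Sum>v\<in>T. fa_scal (f u * g v) (fa_word (u @ v)))"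
    by (rule arg_cong)
  also have "\<dots> = (\<Sum>u\<in>S. symbol (\<Sum>v\<in>T. fa_scal (f u * g v) (fa_word (u @ v))))"
    by (rule symbol_sum) (intro fa_sum_free_alg fa_scal_free_alg fa_word_free_alg, simp add: over)
  also have "\<dots> = (\<Sum>u\<in>S. \<Sum>v\<in>T. symbol (fa_scal (f u * g v) (fa_word (u @ v))))"
    by (intro sum.cong refl symbol_sum fa_scal_free_alg fa_word_free_alg) (simp add: over)
  also have "\<dots> = (\<Sum>u\<in>S. \<Sum>v\<in>T. tmult (single (word_deg u) (single 0 (f u) * word_coeff u)) (single (word_deg v) (single 0 (g v) * word_coeff v)))"
  proof (intro sum.cong refl)
    fix u v
    have "single 0 (f u * g v) = (single 0 (f u) * single 0 (g v) :: 'k lau)" by (simp add: mult_single)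
    then show "symbol (fa_scal (f u * g v) (fa_word (u @ v))) =
        tmult (single (word_deg u) (single 0 (f u) * word_coeff u)) (single (word_deg v) (single 0 (g v) * word_coeff v))"
      by (simp add: symbol_scal_word twisted_mult_single word_deg_append word_coeff_append twist_mult twist_single mult_ac)
  qed
  also have "\<dots> = tmult (symbol f) (symbol g)"
    unfolding symbol_def twisted_mult_sum_left unfolding twisted_mult_sum_right S_def T_def ..
  finally show ?thesis .
qed

lemma twist_gen_coeff:
  assumes "gidx a \<in> {1..n}" "gidx b \<in> {1..n}" "gidx a \<noteq> gidx b"
  shows "twist (gen_deg a) (gen_coeff b) = gen_coeff b"
  using assms
  by (cases a; cases b)
    (simp_all add: twist_diff twist_single chi_single_left chi_single_right lookup_single_not_eq)

text \<open>The one relation that shapes the choice of coefficients: moving X_i past h_i^d - 1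
  produces q_i^d h_i^d - 1, the value of x_i y_i, while in y_i x_i nothing is moved past.\<close>

lemma symbol_rels:
  assumes "f \<in> rels n d q"
  shows "symbol f = 0 \<and> f \<in> free_alg n"
proof -
  from assms consider
    (rel) i where "i \<in> {1..n}"
      "f \<in> {fa_word [GH i, GHi i] - fa_word [],
        fa_word [GHi i, GH i] - fa_word [],
        fa_word [GX i, GH i] - fa_scal (q i) (fa_word [GH i, GX i]),
        fa_word [GY i, GH i] - fa_scal (inverse (q i)) (fa_word [GH i, GY i]),
        fa_word [GX i, GY i] - (fa_scal (q i ^ d) (fa_word (replicate d (GH i))) - fa_word []),
        fa_word [GY i, GX i] - (fa_word (replicate d (GH i)) - fa_word [])}"
  | (comm) a b where "f = fa_word [a, b] - fa_word [b, a]" "gidx a \<in> {1..n}" "gidx b \<in> {1..n}" "gidx a \<noteq> gidx b"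
    unfolding rels_def Let_def fa_diff_eq fa_one_eq fa_gen_eq fa_pow_word fa_word_mult append.simps by blast
  then show ?thesis
  proof cases
    case rel
    have h: "word_deg (replicate k (GH i)) = 0" "word_coeff (replicate k (GH i)) = single (single i (int k)) 1" for k
      by (induction k) (simp_all add: mult_single single_add_same)
    have "over n (replicate d (GH i))" using rel(1) by (simp add: over_replicate)
    with rel show ?thesis
      by (auto simp: symbol_diff symbol_word symbol_scal_word fa_word_free_alg fa_scal_free_alg fa_diff_free_alg
          h left_diff_distrib right_diff_distrib mult_single single_add_same add.commute single_diff twist_single twist_diff chi_single_left lookup_single when_def)
  next
    case comm
    then show ?thesis
      using twist_gen_coeff[of a b] twist_gen_coeff[of b a]
      by (simp add: symbol_diff symbol_word fa_word_free_alg fa_diff_free_alg add.commute mult.commute)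
  qed
qed

text \<open>Both claims are proved in one induction, because \<open>symbol\<close> is additive and
  multiplicative only on \<open>free_alg\<close>.\<close>

lemma symbol_rel_ideal:
  assumes "f \<in> rel_ideal n d q"
  shows "symbol f = 0" "f \<in> free_alg n"
proof -
  have "symbol f = 0 \<and> f \<in> free_alg n"
  proof (rule rel_ideal.induct[OF assms, where P = "\<lambda>f. symbol f = 0 \<and> f \<in> free_alg n"])
    show "symbol fa_zero = 0 \<and> fa_zero \<in> free_alg n" by (simp add: fa_zero_eq fa_zero_free_alg)
  next
    fix r u v :: "'k fa" assume "r \<in> rels n d q" "u \<in> free_alg n" "v \<in> free_alg n"
    then show "symbol (fa_mult u (fa_mult r v)) = 0 \<and> fa_mult u (fa_mult r v) \<in> free_alg n"
      using symbol_rels[of r] by (simp add: symbol_mult fa_mult_free_alg)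
  next
    fix a b assume "symbol a = 0 \<and> a \<in> free_alg n" "symbol b = 0 \<and> b \<in> free_alg n"
    then show "symbol (fa_add a b) = 0 \<and> fa_add a b \<in> free_alg n"
      by (simp add: fa_add_eq symbol_add fa_add_free_alg)
  qed
  then show "symbol f = 0" "f \<in> free_alg n" by simp_all
qed

lemma symbol_cong: "eqA n d q f g \<Longrightarrow> f \<in> free_alg n \<Longrightarrow> g \<in> free_alg n \<Longrightarrow> symbol f = symbol g"
  using symbol_rel_ideal(1)[of "f - g"] by (simp add: eqA_def fa_diff_eq symbol_diff)

text \<open>A discrete intermediate value argument. Reading the word from the left, the evaluation
  point of h_j walks through q_j^k, where k goes up at x_j and down at y_j. It starts at k \<ge> 0
  and ends below 0, so some y_j takes it from 0 to -1, and there the factor h_j^d - 1 is evaluated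
  at 1.\<close>

lemma specialize_word_coeff:
  assumes "over n w" "j \<in> {1..n}" "0 \<le> k" "k < - coeff (word_deg w) j"
  shows "specialize j (q j powi k) (word_coeff w) = 0"
  using assms(1,3,4)
proof (induction w arbitrary: k)
  case (Cons g w)
  have q: "q j \<noteq> 0" by (rule q_nonzero[OF assms(2)])
  have step: "specialize j (q j powi k) (word_coeff (g # w)) = specialize j (q j powi k) (gen_coeff g) *
      twist (gen_deg g) (specialize j (q j powi (k + coeff (gen_deg g) j)) (word_coeff w))"
    using q assms(2) by (simp add: specialize_mult specialize_twist power_int_add)
  show ?case
  proof (cases "k + coeff (gen_deg g) j \<ge> 0")
    case True
    have "specialize j (q j powi (k + coeff (gen_deg g) j)) (word_coeff w) = 0"
      by (rule Cons.IH) (use True Cons.prems in \<open>simp_all add: lookup_add\<close>)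
    then show ?thesis by (simp only: step) simp
  next
    case False
    \<comment> \<open>The first letter already crosses from 0 to -1.\<close>
    then have "g = GY j" "k = 0" using Cons.prems
      by (cases g; simp add: lookup_single when_def split: if_splits)+
    then have "specialize j (q j powi k) (gen_coeff g) = 0"
      by (simp add: specialize_diff specialize_single omit_single)
    then show ?thesis by (simp only: step) simp
  qed
qed simp

lemma specialize_symbol:
  assumes "f \<in> free_alg n" "j \<in> {1..n}" "0 \<le> k" "k < - coeff \<beta> j"
  shows "specialize j (q j powi k) (coeff (symbol f) \<beta>) = 0"
proof -
  have "specialize j (q j powi k) (coeff (single (word_deg w) (single 0 (f w) * word_coeff w)) \<beta>) = 0" if "f w \<noteq> 0" for w
    using specialize_word_coeff[of w j k] free_algD(2)[OF assms(1) that] assms(2-4) q_nonzero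
    by (cases "word_deg w = \<beta>") (auto simp: lookup_single specialize_mult)
  moreover have "specialize j a (sum h S) = (\<Sum>x\<in>S. specialize j a (h x))" for a S and h :: "gen list \<Rightarrow> 'k lau"
    using sum_comp_morphism[of "specialize j a" h S] by (simp add: specialize_add comp_def)
  ultimately show ?thesis
    unfolding symbol_def lookup_sum by simp
qed

end

section \<open>Normal forms\<close>

text \<open>A signed power: m copies of P, or -m copies of M when m is negative. With P and M as
  parameters, the same lemmas serve for h and its inverse and for x and y, and exchanging P and M
  gives the mirrored case.\<close>

definition block :: "(nat \<Rightarrow> gen) \<Rightarrow> (nat \<Rightarrow> gen) \<Rightarrow> int \<Rightarrow> nat \<Rightarrow> gen list" where
  "block P M m j = (if m \<ge> 0 then replicate (nat m) (P j) else replicate (nat (-m)) (M j))"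

definition blocks :: "(nat \<Rightarrow> gen) \<Rightarrow> (nat \<Rightarrow> gen) \<Rightarrow> (nat \<Rightarrow> int) \<Rightarrow> nat list \<Rightarrow> gen list" where
  "blocks P M t js = concat (map (\<lambda>j. block P M (t j) j) js)"

lemma block_swap: "block P M m j = block M P (-m) j"
  by (simp add: block_def)

lemma block_0 [simp]: "block P M 0 j = []"
  by (simp add: block_def)

lemma block_Cons_nonneg: "m \<ge> 0 \<Longrightarrow> P j # block P M m j = block P M (m + 1) j"
  by (simp add: block_def nat_add_distrib)

lemma block_Cons_neg: "m < 0 \<Longrightarrow> block P M m j = M j # block P M (m + 1) j"
proof -
  assume "m < 0"
  then have "nat (-m) = Suc (nat (-(m + 1)))" by simp
  with \<open>m < 0\<close> show ?thesis by (auto simp: block_def)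
qed

lemma blocks_simps [simp]:
  "blocks P M t [] = []" "blocks P M t (j # js) = block P M (t j) j @ blocks P M t js"
  "blocks P M t (js @ ks) = blocks P M t js @ blocks P M t ks"
  by (simp_all add: blocks_def)

lemma blocks_cong: "(\<And>j. j \<in> set js \<Longrightarrow> t j = t' j) \<Longrightarrow> blocks P M t js = blocks P M t' js"
  by (induction js) simp_all

lemma upt_split: "j \<in> {1..n} \<Longrightarrow> [1..<Suc n] = [1..<j] @ j # [Suc j..<Suc n]"
  using upt_add_eq_append[of 1 j "Suc n - j"] upt_conv_Cons[of j "Suc n"] by simp

lemma set_block: "b \<in> set (block P M m j) \<Longrightarrow> b = P j \<or> b = M j"
  by (auto simp: block_def split: if_splits)

lemma set_blocks: "b \<in> set (blocks P M t js) \<Longrightarrow> \<exists>j\<in>set js. b = P j \<or> b = M j"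
  by (auto simp: blocks_def dest: set_block)

abbreviation hword :: "nat \<Rightarrow> ex \<Rightarrow> gen list" where
  "hword n \<alpha> \<equiv> blocks GH GHi (coeff \<alpha>) [1..<Suc n]"

abbreviation vword :: "nat \<Rightarrow> ex \<Rightarrow> gen list" where
  "vword n \<beta> \<equiv> blocks GX GY (coeff \<beta>) [1..<Suc n]"

lemma over_hword: "over n (hword n \<alpha>)" and over_vword: "over n (vword n \<alpha>)"
  by (auto simp: over_def dest!: set_blocks)

lemma over_blocks:
  "set js \<subseteq> {1..n} \<Longrightarrow> over n (blocks GH GHi t js)" "set js \<subseteq> {1..n} \<Longrightarrow> over n (blocks GX GY t js)"
  by (auto simp: over_def subset_eq dest!: set_blocks)

text \<open>Words agree up to a scalar; the scalars play no role for normal forms.\<close>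

definition prop_word :: "nat \<Rightarrow> nat \<Rightarrow> (nat \<Rightarrow> 'k::field) \<Rightarrow> gen list \<Rightarrow> gen list \<Rightarrow> bool" where
  "prop_word n d q u v \<longleftrightarrow> (\<exists>k. eqA n d q (fa_word u) (fa_scal k (fa_word v)))"

lemma prop_word_refl [simp]: "prop_word n d q u u"
  unfolding prop_word_def by (rule exI[of _ 1]) simp

lemma prop_wordI: "eqA n d q (fa_word u) (fa_word v) \<Longrightarrow> prop_word n d q u v"
  unfolding prop_word_def by (rule exI[of _ 1]) simp

lemma prop_word_trans [trans]: "prop_word n d q u v \<Longrightarrow> prop_word n d q v w \<Longrightarrow> prop_word n d q u w"
  unfolding prop_word_def by (metis eqA_trans eqA_scal fa_scal_scal)

lemma prop_word_context: "prop_word n d q u v \<Longrightarrow> over n a \<Longrightarrow> over n b \<Longrightarrow> prop_word n d q (a @ u @ b) (a @ v @ b)"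
  unfolding prop_word_def by (metis eqA_context_scal)

lemma prop_word_move_right:
  assumes "\<And>b. b \<in> set u \<Longrightarrow> prop_word n d q [a, b] [b, a]" "over n u" "over n v"
  shows "prop_word n d q (a # u @ v) (u @ a # v)"
  using assms
proof (induction u)
  case (Cons b u)
  have "prop_word n d q (a # (b # u) @ v) ([b] @ (a # u @ v))"
    using prop_word_context[of n d q "[a, b]" "[b, a]" "[]" "u @ v"] Cons.prems by simp
  also have "prop_word n d q \<dots> ([b] @ (u @ a # v))"
    using prop_word_context[OF Cons.IH, of "[b]" "[]"] Cons.prems by simp
  finally show ?case by simp
qed simp

lemma prop_word_move_left:
  assumes "\<And>a. a \<in> set u \<Longrightarrow> prop_word n d q [a, b] [b, a]" "over n u" "over n v"
  shows "prop_word n d q (u @ b # v) (b # u @ v)"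
  using assms
proof (induction u)
  case (Cons a u)
  have "prop_word n d q ((a # u) @ b # v) ([a] @ (b # u @ v))"
    using prop_word_context[OF Cons.IH, of "[a]" "[]"] Cons.prems by simp
  also have "prop_word n d q \<dots> (b # (a # u) @ v)"
    using prop_word_context[of n d q "[a, b]" "[b, a]" "[]" "u @ v"] Cons.prems by simp
  finally show ?case .
qed simp

section \<open>Rewriting every word into normal words\<close>

context gwa
begin

abbreviation eqv (infix "\<approx>" 50) where "f \<approx> g \<equiv> eqA n d q f g"
abbreviation propto (infix "\<propto>" 50) where "u \<propto> v \<equiv> prop_word n d q u v"

lemma eqA_rels:
  assumes "i \<in> {1..n}"
  shows "fa_word [GH i, GHi i] \<approx> fa_word []" "fa_word [GHi i, GH i] \<approx> fa_word []"
    "fa_word [GX i, GH i] \<approx> fa_scal (q i) (fa_word [GH i, GX i])"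
    "fa_word [GY i, GH i] \<approx> fa_scal (inverse (q i)) (fa_word [GH i, GY i])"
    "fa_word [GX i, GY i] \<approx> fa_scal (q i ^ d) (fa_word (replicate d (GH i))) - fa_word []"
    "fa_word [GY i, GX i] \<approx> fa_scal 1 (fa_word (replicate d (GH i))) - fa_word []"
  unfolding eqA_def
  by (rule rels_rel_ideal, use assms in \<open>auto simp: rels_def Let_def fa_diff_eq fa_one_eq fa_gen_eq fa_pow_word fa_word_mult\<close>)+

lemma eqA_commute:
  assumes "gidx a \<in> {1..n}" "gidx b \<in> {1..n}" "gidx a \<noteq> gidx b"
  shows "fa_word [a, b] \<approx> fa_word [b, a]"
  unfolding eqA_def
  by (rule rels_rel_ideal, unfold rels_def, rule UnI2, rule CollectI, rule exI[of _ a], rule exI[of _ b])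
    (use assms in \<open>simp add: fa_diff_eq fa_gen_eq fa_word_mult\<close>)

text \<open>The relations do not mention the inverse of h next to x or y. Inserting h h^-1 on the
  right gives h^-1 a = h^-1 (a h) h^-1 = c a h^-1, and c is invertible.\<close>

lemma prop_inverse:
  assumes "fa_word [a, GH j] \<approx> fa_scal c (fa_word [GH j, a])" "gidx a = j" "j \<in> {1..n}" "c \<noteq> 0"
  shows "[a, GHi j] \<propto> [GHi j, a]"
proof -
  note rel = eqA_rels(1,2)[OF assms(3)]
  have ov: "over n [a]" "over n [GHi j]" "over n [a, GHi j]" "over n [GHi j, a]" "over n []" using assms by simp_all
  have "fa_word ([GHi j, a] @ [GH j, GHi j] @ []) \<approx> fa_scal 1 (fa_word ([GHi j, a] @ [] @ []))"
    by (rule eqA_context_scal) (use rel ov in simp_all)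
  then have 1: "fa_word [GHi j, a] \<approx> fa_word [GHi j, a, GH j, GHi j]"
    by (simp add: eqA_sym)
  have "fa_word ([GHi j] @ [a, GH j] @ [GHi j]) \<approx> fa_scal c (fa_word ([GHi j] @ [GH j, a] @ [GHi j]))"
    by (rule eqA_context_scal[OF assms(1)]) (use ov in simp_all)
  then have 2: "fa_word [GHi j, a, GH j, GHi j] \<approx> fa_scal c (fa_word [GHi j, GH j, a, GHi j])" by simp
  have "fa_word ([] @ [GHi j, GH j] @ [a, GHi j]) \<approx> fa_scal 1 (fa_word ([] @ [] @ [a, GHi j]))"
    by (rule eqA_context_scal) (use rel ov in simp_all)
  then have 3: "fa_scal c (fa_word [GHi j, GH j, a, GHi j]) \<approx> fa_scal c (fa_word [a, GHi j])"
    by (intro eqA_scal) simp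
  have "fa_word [GHi j, a] \<approx> fa_scal c (fa_word [a, GHi j])"
    using 1 2 3 eqA_trans by blast
  from eqA_scal[OF this, of "inverse c"] have "fa_word [a, GHi j] \<approx> fa_scal (inverse c) (fa_word [GHi j, a])"
    using \<open>c \<noteq> 0\<close> by (simp add: fa_scal_scal eqA_sym)
  then show ?thesis unfolding prop_word_def by blast
qed

lemma prop_swap:
  assumes "gidx a \<in> {1..n}" "gidx b \<in> {1..n}" "gidx a \<noteq> gidx b \<or> b = GH j \<or> b = GHi j"
  shows "[a, b] \<propto> [b, a]"
proof (cases "gidx a = gidx b")
  case True
  with assms have j: "gidx a = j" "j \<in> {1..n}" and b: "b = GH j \<or> b = GHi j" by auto
  note rel = eqA_rels[OF j(2)]
  have "[GH j, GHi j] \<propto> [GHi j, GH j]" "[GHi j, GH j] \<propto> [GH j, GHi j]"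
    using rel(1,2) by (blast intro: prop_wordI eqA_trans eqA_sym)+
  moreover have "[GX j, GH j] \<propto> [GH j, GX j]" "[GY j, GH j] \<propto> [GH j, GY j]"
    unfolding prop_word_def using rel(3,4) by blast+
  moreover have "[GX j, GHi j] \<propto> [GHi j, GX j]" "[GY j, GHi j] \<propto> [GHi j, GY j]"
    by (rule prop_inverse[OF rel(3)] prop_inverse[OF rel(4)], use j q_nonzero[of j] in simp_all)+
  ultimately show ?thesis using j(1) b by (cases a) auto
qed (use assms eqA_commute in \<open>blast intro: prop_wordI\<close>)

text \<open>The normal words read only the coordinates 1..n, so an exponent is recovered from its
  word only inside this set.\<close>

definition expo :: "ex set" where
  "expo = {\<alpha>. keys \<alpha> \<subseteq> {1..n}}"

lemma expo_add: "\<alpha> \<in> expo \<Longrightarrow> \<beta> \<in> expo \<Longrightarrow> \<alpha> + \<beta> \<in> expo"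
  unfolding expo_def using Poly_Mapping.keys_add[of \<alpha> \<beta>] by blast

lemma expo_zero: "0 \<in> expo" by (simp add: expo_def)

lemma expo_single: "j \<in> {1..n} \<Longrightarrow> single j m \<in> expo"
  by (simp add: expo_def)

lemma word_deg_expo: "over n w \<Longrightarrow> word_deg w \<in> expo"
proof (induction w)
  case (Cons g w)
  then have "gen_deg g \<in> expo" by (cases g) (auto simp: expo_zero intro: expo_single)
  with Cons show ?case by (simp add: expo_add)
qed (simp add: expo_zero)

definition nf :: "'k lau \<Rightarrow> ex \<Rightarrow> 'k fa" where
  "nf c \<beta> = pm_extend (\<lambda>\<alpha> x. fa_scal x (fa_word (hword n \<alpha> @ vword n \<beta>))) c"

lemma nf_add: "nf (c + c') \<beta> = nf c \<beta> + nf c' \<beta>"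
  unfolding nf_def by (rule pm_extend_add) (simp_all add: fa_scal_add_left)

lemma nf_zero [simp]: "nf 0 \<beta> = 0"
  by (simp add: nf_def)

lemma nf_single: "nf (single \<alpha> x) \<beta> = fa_scal x (fa_word (hword n \<alpha> @ vword n \<beta>))"
  unfolding nf_def by (subst pm_extend_single) simp_all

lemma nf_scal: "nf (single 0 x * c) \<beta> = fa_scal x (nf c \<beta>)"
  by (induction c rule: pm_induct)
    (simp_all add: mult_single nf_single nf_add distrib_left fa_scal_add fa_scal_scal)

lemma nf_sum: "nf (\<Sum>x\<in>S. c x) \<beta> = (\<Sum>x\<in>S. nf (c x) \<beta>)"
  using sum_comp_morphism[of "\<lambda>c. nf c \<beta>" c S] by (simp add: nf_add comp_def)

text \<open>The X-degree \<beta> part of A: Laurent polynomials in the h times the one word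
  \<open>vword n \<beta>\<close>. This is the standard description of a generalized Weyl
  algebra.\<close>

definition NF :: "ex \<Rightarrow> 'k fa set" where
  "NF \<beta> = {f. \<exists>c. keys c \<subseteq> expo \<and> f \<approx> nf c \<beta>}"

lemma NF_cong: "f \<approx> g \<Longrightarrow> g \<in> NF \<beta> \<Longrightarrow> f \<in> NF \<beta>"
  unfolding NF_def using eqA_trans by blast

lemma NF_zero: "0 \<in> NF \<beta>"
  unfolding NF_def by (simp add: exI[of _ 0])

lemma NF_add: "f \<in> NF \<beta> \<Longrightarrow> g \<in> NF \<beta> \<Longrightarrow> f + g \<in> NF \<beta>"
proof -
  assume "f \<in> NF \<beta>" "g \<in> NF \<beta>"
  then obtain c c' where "keys c \<subseteq> expo" "f \<approx> nf c \<beta>" "keys c' \<subseteq> expo" "g \<approx> nf c' \<beta>" unfolding NF_def by blast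
  then have "keys (c + c') \<subseteq> expo" "f + g \<approx> nf (c + c') \<beta>"
    using Poly_Mapping.keys_add[of c c'] by (auto simp: nf_add eqA_add)
  then show ?thesis unfolding NF_def by blast
qed

lemma keys_scal: "keys (single 0 x * c) \<subseteq> keys (c :: 'k lau)"
  using keys_mult[of "single 0 x" c] by (auto split: if_splits)

lemma NF_scal: "f \<in> NF \<beta> \<Longrightarrow> fa_scal x f \<in> NF \<beta>"
proof -
  assume "f \<in> NF \<beta>"
  then obtain c where "keys c \<subseteq> expo" "f \<approx> nf c \<beta>" unfolding NF_def by blast
  then have "keys (single 0 x * c) \<subseteq> expo" "fa_scal x f \<approx> nf (single 0 x * c) \<beta>"
    using keys_scal[of x c] by (auto simp: nf_scal eqA_scal)
  then show ?thesis unfolding NF_def by blast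
qed

lemma NF_diff: "f \<in> NF \<beta> \<Longrightarrow> g \<in> NF \<beta> \<Longrightarrow> f - g \<in> NF \<beta>"
proof -
  have "f - g = f + fa_scal (-1) g" by (simp add: fa_scal_def fun_eq_iff fun_apply)
  then show "f \<in> NF \<beta> \<Longrightarrow> g \<in> NF \<beta> \<Longrightarrow> f - g \<in> NF \<beta>" by (metis NF_add NF_scal)
qed

lemma NF_word: "\<alpha> \<in> expo \<Longrightarrow> fa_word (hword n \<alpha> @ vword n \<beta>) \<in> NF \<beta>"
proof -
  assume "\<alpha> \<in> expo"
  then have "keys (single \<alpha> (1::'k)) \<subseteq> expo" "fa_word (hword n \<alpha> @ vword n \<beta>) \<approx> nf (single \<alpha> 1) \<beta>"
    by (simp_all add: nf_single)
  then show ?thesis unfolding NF_def by blast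
qed

lemma NF_prop: "u \<propto> v \<Longrightarrow> fa_word v \<in> NF \<beta> \<Longrightarrow> fa_word u \<in> NF \<beta>"
  unfolding prop_word_def using NF_cong NF_scal by blast

lemma NF_mult_gen:
  assumes "gidx g \<in> {1..n}" and "f \<in> NF \<beta>"
    and words: "\<And>\<alpha>. \<alpha> \<in> expo \<Longrightarrow> fa_word (g # hword n \<alpha> @ vword n \<beta>) \<in> NF \<gamma>"
  shows "fa_mult (fa_word [g]) f \<in> NF \<gamma>"
proof -
  obtain c where c: "keys c \<subseteq> expo" "f \<approx> nf c \<beta>" using assms(2) unfolding NF_def by blast
  have "fa_mult (fa_word [g]) f \<approx> fa_mult (fa_word [g]) (nf c \<beta>)"
    by (rule eqA_mult_left[OF c(2)]) (use assms(1) in \<open>simp add: fa_word_free_alg\<close>)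
  moreover have "fa_mult (fa_word [g]) (nf c \<beta>) \<in> NF \<gamma>"
    unfolding nf_def pm_extend_def fa_mult_sum_right
  proof (rule sum_closed[where P = "\<lambda>f. f \<in> NF \<gamma>"])
    fix \<alpha> assume "\<alpha> \<in> keys c"
    then have "fa_word (g # hword n \<alpha> @ vword n \<beta>) \<in> NF \<gamma>" using c(1) words by blast
    then show "fa_mult (fa_word [g]) (fa_scal (coeff c \<alpha>) (fa_word (hword n \<alpha> @ vword n \<beta>))) \<in> NF \<gamma>"
      by (simp add: fa_mult_scal_right fa_word_mult NF_scal)
  qed (simp_all add: NF_zero NF_add)
  ultimately show ?thesis by (rule NF_cong)
qed

text \<open>Covers multiplication by \<open>h\<^sub>j\<close> and by its inverse.\<close>

lemma NF_h_word:
  fixes s :: int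
  assumes j: "j \<in> {1..n}" and PM: "P = GH \<and> M = GHi \<and> s = 1 \<or> P = GHi \<and> M = GH \<and> s = -1" and "\<alpha> \<in> expo"
  shows "fa_word (P j # hword n \<alpha> @ vword n \<beta>) \<in> NF \<beta>"
proof -
  define A B C where "A = blocks GH GHi (coeff \<alpha>) [1..<j]" and "B = block GH GHi (coeff \<alpha> j) j"
    and "C = blocks GH GHi (coeff \<alpha>) [Suc j..<Suc n]"
  have split: "hword n \<gamma> = A @ block GH GHi (coeff \<gamma> j) j @ C" if "\<And>i. i \<noteq> j \<Longrightarrow> coeff \<gamma> i = coeff \<alpha> i" for \<gamma>
    using blocks_cong[of "[1..<j]" "coeff \<gamma>" "coeff \<alpha>" GH GHi] blocks_cong[of "[Suc j..<Suc n]" "coeff \<gamma>" "coeff \<alpha>" GH GHi] that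
    unfolding upt_split[OF j] A_def C_def by simp
  have ov: "over n A" "over n C" "over n (vword n \<beta>)" using j by (auto simp: A_def C_def over_vword intro!: over_blocks(1))
  \<comment> \<open>Counting the exponent in terms of the incoming letter P turns both sign choices
    into a step from an exponent to its successor: P is adjoined, or it cancels a leading M.\<close>
  have B: "B = block P M (s * coeff \<alpha> j) j" using PM block_swap[of GH GHi] by (auto simp: B_def)
  have ovB: "over n (block P M m j)" for m using j PM by (auto simp: over_def dest!: set_block)
  have idx: "gidx (P j) \<in> {1..n}" using j PM by auto
  have "P j # A @ B @ C @ vword n \<beta> \<propto> A @ P j # B @ C @ vword n \<beta>"
  proof (rule prop_word_move_right)
    fix b assume "b \<in> set A"
    then obtain i where "i \<in> {1..<j}" "b = GH i \<or> b = GHi i" unfolding A_def by (auto dest!: set_blocks)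
    then show "[P j, b] \<propto> [b, P j]" by (intro prop_swap[of _ _ i]) (use j PM in auto)
  qed (use ov ovB B in simp_all)
  also have "A @ P j # B @ C @ vword n \<beta> \<propto> A @ block P M (s * coeff \<alpha> j + 1) j @ C @ vword n \<beta>"
  proof (cases "s * coeff \<alpha> j \<ge> 0")
    case True
    show ?thesis using block_Cons_nonneg[OF True, of P j M] by (metis B append_Cons prop_word_refl)
  next
    case False
    let ?B' = "block P M (s * coeff \<alpha> j + 1) j"
    have rel: "[P j, M j] \<propto> []" using PM eqA_rels(1,2)[OF j] by (auto intro: prop_wordI)
    have "B = M j # ?B'" unfolding B by (rule block_Cons_neg) (use False in simp)
    then show ?thesis
      using prop_word_context[OF rel, of A "?B' @ C @ vword n \<beta>"] ov ovB by simp
  qed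
  also have "block P M (s * coeff \<alpha> j + 1) j = block GH GHi (coeff (\<alpha> + single j s) j) j"
    using PM block_swap[of GH GHi "coeff \<alpha> j - 1"] by (auto simp: lookup_add)
  finally have "P j # hword n \<alpha> @ vword n \<beta> \<propto> hword n (\<alpha> + single j s) @ vword n \<beta>"
    using split[of \<alpha>] split[of "\<alpha> + single j s"] by (simp add: B_def lookup_add lookup_single_not_eq)
  then show ?thesis
    by (rule NF_prop) (intro NF_word expo_add expo_single assms)
qed

lemma NF_h:
  assumes "j \<in> {1..n}" "f \<in> NF \<beta>"
  shows "fa_mult (fa_word [GH j]) f \<in> NF \<beta>" "fa_mult (fa_word [GHi j]) f \<in> NF \<beta>"
proof -
  show "fa_mult (fa_word [GH j]) f \<in> NF \<beta>"
    by (rule NF_mult_gen[OF _ assms(2)]) (use assms(1) NF_h_word[of j GH GHi 1] in simp_all)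
  show "fa_mult (fa_word [GHi j]) f \<in> NF \<beta>"
    by (rule NF_mult_gen[OF _ assms(2)]) (use assms(1) NF_h_word[of j GHi GH "-1"] in simp_all)
qed

text \<open>Cancelling x_j against y_j leaves powers of h_j in the middle of a word; they can be
  carried to the front, where multiplication by h_j preserves the normal form.\<close>

lemma NF_h_inside:
  assumes "j \<in> {1..n}" "over n u" "over n v" "fa_word (u @ v) \<in> NF \<beta>"
  shows "fa_word (u @ replicate k (GH j) @ v) \<in> NF \<beta>"
proof (induction k)
  case (Suc k)
  have "u @ GH j # replicate k (GH j) @ v \<propto> GH j # u @ replicate k (GH j) @ v"
  proof (rule prop_word_move_left)
    fix a assume "a \<in> set u"
    then show "[a, GH j] \<propto> [GH j, a]" using assms(1,2) by (intro prop_swap[of _ _ j]) (auto simp: over_def)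
  qed (use assms in \<open>simp_all add: over_replicate\<close>)
  moreover have "fa_word (GH j # u @ replicate k (GH j) @ v) \<in> NF \<beta>"
    using NF_h(1)[OF assms(1) Suc] by (simp add: fa_word_mult)
  ultimately show ?case by (simp add: NF_prop)
qed (simp add: assms)

text \<open>Covers multiplication by \<open>x\<^sub>j\<close> and by \<open>y\<^sub>j\<close>.\<close>

lemma NF_v_word:
  fixes s :: int
  assumes j: "j \<in> {1..n}" and PM: "P = GX \<and> M = GY \<and> s = 1 \<or> P = GY \<and> M = GX \<and> s = -1" and "\<alpha> \<in> expo"
  shows "fa_word (P j # hword n \<alpha> @ vword n \<beta>) \<in> NF (single j s + \<beta>)"
proof -
  define A B C where "A = blocks GX GY (coeff \<beta>) [1..<j]" and "B = block GX GY (coeff \<beta> j) j"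
    and "C = blocks GX GY (coeff \<beta>) [Suc j..<Suc n]"
  have split: "vword n \<gamma> = A @ block GX GY (coeff \<gamma> j) j @ C" if "\<And>i. i \<noteq> j \<Longrightarrow> coeff \<gamma> i = coeff \<beta> i" for \<gamma>
    using blocks_cong[of "[1..<j]" "coeff \<gamma>" "coeff \<beta>" GX GY] blocks_cong[of "[Suc j..<Suc n]" "coeff \<gamma>" "coeff \<beta>" GX GY] that
    unfolding upt_split[OF j] A_def C_def by simp
  let ?h = "hword n \<alpha>" and ?\<beta>' = "single j s + \<beta>" and ?B' = "block P M (s * coeff \<beta> j + 1) j"
  have ov: "over n A" "over n C" "over n ?h" using j by (auto simp: A_def C_def over_hword intro!: over_blocks(2))
  have B: "B = block P M (s * coeff \<beta> j) j" using PM block_swap[of GX GY] by (auto simp: B_def)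
  have ovB: "over n (block P M m j)" for m using j PM by (auto simp: over_def dest!: set_block)
  have "?B' = block GX GY (coeff ?\<beta>' j) j"
    using PM block_swap[of GX GY "coeff \<beta> j - 1"] by (auto simp: lookup_add add.commute)
  then have \<beta>': "vword n ?\<beta>' = A @ ?B' @ C"
    using split[of ?\<beta>'] by (simp add: lookup_add lookup_single_not_eq)
  have "P j # (?h @ A) @ B @ C \<propto> (?h @ A) @ P j # B @ C"
  proof (rule prop_word_move_right)
    fix b assume "b \<in> set (?h @ A)"
    then obtain i where "i \<in> {1..n}" "i < j \<or> b = GH i \<or> b = GHi i" "gidx b = i"
      unfolding A_def using j by (auto dest!: set_blocks)
    then show "[P j, b] \<propto> [b, P j]" by (intro prop_swap[of _ _ i]) (use j PM in auto)
  qed (use ov ovB B in simp_all)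
  then have move: "P j # ?h @ vword n \<beta> \<propto> (?h @ A) @ P j # B @ C"
    using split[of \<beta>] by (simp add: B_def)
  have target: "fa_word ((?h @ A) @ ?B' @ C) \<in> NF ?\<beta>'"
    using NF_word[OF assms(3), of ?\<beta>'] \<beta>' by simp
  have "fa_word ((?h @ A) @ P j # B @ C) \<in> NF ?\<beta>'"
  proof (cases "s * coeff \<beta> j \<ge> 0")
    case True
    then have "P j # B = ?B'" using block_Cons_nonneg[OF True, of P j M] by (simp add: B)
    then show ?thesis using target by (metis append_Cons)
  next
    case False
    have B': "B = M j # ?B'" unfolding B by (rule block_Cons_neg) (use False in simp)
    \<comment> \<open>The pair is not replaced by the empty word but by c h_j^d - 1, with c = q_j^d
      or c = 1. The two resulting words have the same X-degree, so both lie in the same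
      \<open>NF\<close>.\<close>
    obtain c where "fa_word [P j, M j] \<approx> fa_scal c (fa_word (replicate d (GH j))) - fa_word []"
      using PM eqA_rels(5,6)[OF j] by blast
    then have "fa_word ((?h @ A) @ [P j, M j] @ ?B' @ C) \<approx> fa_mult (fa_word (?h @ A))
        (fa_mult (fa_scal c (fa_word (replicate d (GH j))) - fa_word []) (fa_word (?B' @ C)))"
      by (rule eqA_context) (use ov ovB in simp_all)
    then have "fa_word ((?h @ A) @ P j # B @ C) \<approx>
        fa_scal c (fa_word ((?h @ A) @ replicate d (GH j) @ ?B' @ C)) - fa_word ((?h @ A) @ ?B' @ C)"
      by (simp add: B' fa_mult_diff_left fa_mult_diff_right fa_mult_scal_left fa_mult_scal_right fa_word_mult)
    moreover have "fa_scal c (fa_word ((?h @ A) @ replicate d (GH j) @ ?B' @ C)) - fa_word ((?h @ A) @ ?B' @ C) \<in> NF ?\<beta>'"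
      by (intro NF_diff NF_scal NF_h_inside target) (use j ov ovB in simp_all)
    ultimately show ?thesis by (rule NF_cong)
  qed
  with move show ?thesis by (rule NF_prop)
qed

lemma word_NF: "over n w \<Longrightarrow> fa_word w \<in> NF (word_deg w)"
proof (induction w)
  case Nil
  have "hword n 0 @ vword n 0 = []" by (simp add: blocks_def)
  then show ?case using NF_word[OF expo_zero, of 0] by simp
next
  case (Cons g w)
  then have g: "gidx g \<in> {1..n}" and IH: "fa_word w \<in> NF (word_deg w)" by simp_all
  have "fa_mult (fa_word [g]) (fa_word w) \<in> NF (gen_deg g + word_deg w)"
  proof (rule NF_mult_gen[OF g IH])
    fix \<alpha> assume "\<alpha> \<in> expo"
    then show "fa_word (g # hword n \<alpha> @ vword n (word_deg w)) \<in> NF (gen_deg g + word_deg w)"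
      using g NF_h_word[of _ GH GHi 1] NF_h_word[of _ GHi GH "-1"] NF_v_word[of _ GX GY 1] NF_v_word[of _ GY GX "-1"]
      by (cases g) simp_all
  qed
  then show ?case by (simp add: fa_word_mult)
qed

lemma normal_form:
  assumes "f \<in> free_alg n"
  obtains B D where "finite B" "B \<subseteq> expo" "\<And>\<beta>. keys (D \<beta>) \<subseteq> expo" "f \<approx> (\<Sum>\<beta>\<in>B. nf (D \<beta>) \<beta>)"
proof -
  define S where "S = {w. f w \<noteq> 0}"
  have fin: "finite S" and over: "\<And>w. w \<in> S \<Longrightarrow> over n w"
    using free_algD[OF assms] by (auto simp: S_def)
  have "\<exists>c. keys c \<subseteq> expo \<and> fa_word w \<approx> nf c (word_deg w)" if "w \<in> S" for w
    using word_NF[OF over[OF that]] unfolding NF_def by blast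
  then obtain C where C: "\<And>w. w \<in> S \<Longrightarrow> keys (C w) \<subseteq> expo \<and> fa_word w \<approx> nf (C w) (word_deg w)" by metis
  define D where "D \<beta> = (\<Sum>w\<in>{w\<in>S. word_deg w = \<beta>}. single 0 (f w) * C w)" for \<beta>
  have "keys (D \<beta>) \<subseteq> expo" for \<beta>
    unfolding D_def using Poly_Mapping.keys_sum[of "\<lambda>w. single 0 (f w) * C w"] keys_scal C by fastforce
  moreover have "f = (\<Sum>w\<in>S. fa_scal (f w) (fa_word w))"
    by (rule fa_expand) (simp_all add: fin, simp add: S_def)
  moreover have "(\<Sum>w\<in>S. fa_scal (f w) (fa_word w)) \<approx> (\<Sum>w\<in>S. nf (single 0 (f w) * C w) (word_deg w))"
    by (rule eqA_sum) (simp add: nf_scal eqA_scal C)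
  moreover have "(\<Sum>w\<in>S. nf (single 0 (f w) * C w) (word_deg w)) = (\<Sum>\<beta>\<in>word_deg ` S. nf (D \<beta>) \<beta>)"
    unfolding D_def nf_sum by (subst sum.group[symmetric, OF fin finite_imageI[OF fin] order_refl]) (auto intro!: sum.cong)
  moreover have "word_deg ` S \<subseteq> expo" using word_deg_expo over by blast
  ultimately show thesis using that[of "word_deg ` S" D] fin by simp
qed

section \<open>Symbols of normal forms and faithfulness of the embedding\<close>

lemma word_deg_h: "word_deg (blocks GH GHi t js) = 0"
proof -
  have "word_deg (block GH GHi m j) = 0" for m j
  proof -
    have "word_deg (replicate k (GH j)) = 0" "word_deg (replicate k (GHi j)) = 0" for k by (induction k) simp_all
    then show ?thesis by (simp add: block_def)
  qed
  then show ?thesis by (induction js) (simp_all add: word_deg_append)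
qed

lemma word_coeff_h: "word_coeff (blocks GH GHi t js) = single (\<Sum>j\<leftarrow>js. single j (t j)) 1"
proof -
  have "word_coeff (block GH GHi m j) = single (single j m) 1" "word_deg (block GH GHi m j) = 0" for m j
  proof -
    have "word_coeff (replicate k (GH j)) = single (single j (int k)) 1" "word_coeff (replicate k (GHi j)) = single (single j (- int k)) 1" for k
      by (induction k) (simp_all add: mult_single single_add_same)
    then show "word_coeff (block GH GHi m j) = single (single j m) 1" by (simp add: block_def)
    show "word_deg (block GH GHi m j) = 0" using word_deg_h[of "\<lambda>_. m" "[j]"] by simp
  qed
  then show ?thesis by (induction js) (simp_all add: word_coeff_append mult_single)
qed

lemma word_deg_v: "word_deg (blocks GX GY t js) = (\<Sum>j\<leftarrow>js. single j (t j))"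
proof -
  have "word_deg (block GX GY m j) = single j m" for m j
  proof -
    have "word_deg (replicate k (GX j)) = single j (int k)" "word_deg (replicate k (GY j)) = single j (- int k)" for k
      by (induction k) (simp_all add: single_add_same)
    then show ?thesis by (simp add: block_def)
  qed
  then show ?thesis by (induction js) (simp_all add: word_deg_append)
qed

lemma lookup_sum_singles: "coeff (\<Sum>j\<leftarrow>[1..<Suc n]. single j (t j)) i = (if i \<in> {1..n} then t i else 0)" for t :: "nat \<Rightarrow> int"
proof -
  have "(\<Sum>j\<leftarrow>[1..<Suc n]. single j (t j)) = (\<Sum>j\<in>{1..n}. single j (t j))"
    by (simp add: sum_list_distinct_conv_sum_set atLeastLessThanSuc_atLeastAtMost)
  then show ?thesis by (auto simp: lookup_sum lookup_single when_def)
qed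

lemma sum_singles_expo: "\<alpha> \<in> expo \<Longrightarrow> (\<Sum>j\<leftarrow>[1..<Suc n]. single j (coeff \<alpha> j)) = \<alpha>"
  by (rule poly_mapping_eqI) (auto simp: lookup_sum_singles expo_def in_keys_iff subset_eq)

lemma word_coeff_nonzero: "word_coeff w \<noteq> 0"
proof (induction w)
  case (Cons g w)
  have "gen_coeff g \<noteq> 0"
  proof (cases g)
    case (GY j)
    have "single j (int d) \<noteq> 0" using d_pos by (metis lookup_single_eq lookup_zero not_one_le_zero of_nat_eq_0_iff)
    then show ?thesis using GY binomial_nonzero[of "single j (int d)" "1::'k"] by simp
  qed (metis gen_coeff.simps lookup_single_eq lookup_zero zero_neq_one)+
  with Cons show ?case using twist_eq_0 by auto
qed simp

text \<open>The factor \<open>word_coeff (vword n \<beta>)\<close> is nonzero in a domain, so c can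
  be recovered from the symbol.\<close>

lemma symbol_nf:
  assumes "keys c \<subseteq> expo" "\<beta> \<in> expo"
  shows "symbol (nf c \<beta>) = single \<beta> (c * word_coeff (vword n \<beta>))" "nf c \<beta> \<in> free_alg n"
proof -
  have free: "fa_scal x (fa_word (hword n \<alpha> @ vword n \<beta>)) \<in> free_alg n" for x :: 'k and \<alpha>
    by (intro fa_scal_free_alg fa_word_free_alg) (simp add: over_hword over_vword)
  show "nf c \<beta> \<in> free_alg n" unfolding nf_def pm_extend_def by (rule fa_sum_free_alg) (rule free)
  have "symbol (nf c \<beta>) = (\<Sum>\<alpha>\<in>keys c. symbol (fa_scal (coeff c \<alpha>) (fa_word (hword n \<alpha> @ vword n \<beta>))))"
    unfolding nf_def pm_extend_def by (rule symbol_sum) (rule free)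
  also have "\<dots> = (\<Sum>\<alpha>\<in>keys c. single \<beta> (single \<alpha> (coeff c \<alpha>) * word_coeff (vword n \<beta>)))"
  proof (rule sum.cong[OF refl])
    fix \<alpha> assume "\<alpha> \<in> keys c"
    then have "\<alpha> \<in> expo" using assms(1) by blast
    then show "symbol (fa_scal (coeff c \<alpha>) (fa_word (hword n \<alpha> @ vword n \<beta>))) = single \<beta> (single \<alpha> (coeff c \<alpha>) * word_coeff (vword n \<beta>))"
      using assms(2)
      by (simp add: symbol_scal_word word_deg_append word_coeff_append word_deg_h word_coeff_h word_deg_v sum_singles_expo
          mult_single mult.assoc[symmetric])
  qed
  also have "\<dots> = single \<beta> ((\<Sum>\<alpha>\<in>keys c. single \<alpha> (coeff c \<alpha>)) * word_coeff (vword n \<beta>))"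
    using sum_comp_morphism[of "single \<beta>" "\<lambda>\<alpha>. single \<alpha> (coeff c \<alpha>) * word_coeff (vword n \<beta>)" "keys c"]
    by (simp add: single_add comp_def sum_distrib_right)
  also have "(\<Sum>\<alpha>\<in>keys c. single \<alpha> (coeff c \<alpha>)) = c"
    by (rule poly_mapping_eqI) (auto simp: lookup_sum lookup_single when_def in_keys_iff)
  finally show "symbol (nf c \<beta>) = single \<beta> (c * word_coeff (vword n \<beta>))" .
qed

lemma symbol_normal_form:
  assumes "f \<in> free_alg n" "finite B" "B \<subseteq> expo" "\<And>\<beta>. keys (D \<beta>) \<subseteq> expo" "f \<approx> (\<Sum>\<beta>\<in>B. nf (D \<beta>) \<beta>)"
  shows "coeff (symbol f) \<beta> = (if \<beta> \<in> B then D \<beta> * word_coeff (vword n \<beta>) else 0)"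
proof -
  have "symbol f = symbol (\<Sum>\<beta>\<in>B. nf (D \<beta>) \<beta>)"
    by (rule symbol_cong[OF assms(5,1)]) (use assms symbol_nf(2) in \<open>blast intro: fa_sum_free_alg\<close>)
  also have "\<dots> = (\<Sum>\<beta>\<in>B. symbol (nf (D \<beta>) \<beta>))"
    by (rule symbol_sum) (use assms symbol_nf(2) in blast)
  also have "\<dots> = (\<Sum>\<beta>\<in>B. single \<beta> (D \<beta> * word_coeff (vword n \<beta>)))"
    by (rule sum.cong[OF refl]) (use assms symbol_nf(1) in blast)
  finally show ?thesis using assms(2) by (simp add: lookup_sum lookup_single when_def)
qed

text \<open>The condition that a torus element must meet in order to come from A. It later supplies
  the cofactors from which p and p' are built.\<close>

lemma symbol_divisible:
  assumes "f \<in> free_alg n"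
  obtains c where "keys c \<subseteq> expo" "coeff (symbol f) \<beta> = c * word_coeff (vword n \<beta>)"
proof -
  obtain B D where BD: "finite B" "B \<subseteq> expo" "\<And>\<beta>. keys (D \<beta>) \<subseteq> expo" "f \<approx> (\<Sum>\<beta>\<in>B. nf (D \<beta>) \<beta>)"
    using normal_form[OF assms] by blast
  from symbol_normal_form[OF assms BD, of \<beta>] show thesis
    using that[of "if \<beta> \<in> B then D \<beta> else 0"] BD(3) by (auto split: if_splits)
qed

text \<open>Faithfulness: in a normal form of f - g each Laurent coefficient becomes zero after
  multiplication by a nonzero element of a domain. All congruences of the theorem are obtained
  through this lemma.\<close>

lemma eqA_if_symbol_eq:
  assumes "f \<in> free_alg n" "g \<in> free_alg n" "symbol f = symbol g"
  shows "f \<approx> g"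
proof -
  have fg: "f - g \<in> free_alg n" "symbol (f - g) = 0" using assms by (simp_all add: fa_diff_free_alg symbol_diff)
  obtain B D where BD: "finite B" "B \<subseteq> expo" "\<And>\<beta>. keys (D \<beta>) \<subseteq> expo" "f - g \<approx> (\<Sum>\<beta>\<in>B. nf (D \<beta>) \<beta>)"
    using normal_form[OF fg(1)] by blast
  have "D \<beta> = 0" if "\<beta> \<in> B" for \<beta>
    using symbol_normal_form[OF fg(1) BD, of \<beta>] that fg(2) word_coeff_nonzero by simp
  then have "(\<Sum>\<beta>\<in>B. nf (D \<beta>) \<beta>) = 0" by simp
  with BD(4) show ?thesis by (simp add: eqA_def fa_diff_eq)
qed

end

section \<open>Homomorphisms\<close>

definition laurent_coeff :: "nat \<Rightarrow> (int \<Rightarrow> 'k::field) \<Rightarrow> 'k lau" where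
  "laurent_coeff j p = (\<Sum>k\<in>{k. p k \<noteq> 0}. single (single j k) (p k))"

lemma single_inject: "single a x = single a y \<Longrightarrow> x = y"
  by (metis lookup_single_eq)

lemma single_eq_one:
  assumes "single \<alpha> (c::'k::field) = 1"
  shows "\<alpha> = 0" "c = 1"
proof -
  from assms have "coeff (single \<alpha> c) 0 = 1" by simp
  then show "\<alpha> = 0" "c = 1" by (auto simp: lookup_single when_def split: if_splits)
qed

text \<open>All keys lie on the line through t in direction j, and p lists the coefficients along
  it. The condition \<open>coeff t j = 0\<close> makes t the base point of that line, with the
  powers of h_j left to p.\<close>

lemma homogeneous_eq_laurent:
  fixes f :: "'k::field lau"
  assumes "\<And>a. a \<in> keys f \<Longrightarrow> omit j a = t" and "coeff t j = 0"
  obtains p where "p \<in> laurent" "f = laurent_coeff j p * single t 1"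
proof
  define p where "p k = coeff f (t + single j k)" for k
  have inj: "inj (\<lambda>k. t + single j k :: ex)"
    by (rule injI) (metis add_left_cancel lookup_single_eq)
  have "finite ((\<lambda>k. t + single j k) -` keys f)"
    by (rule finite_vimageI[OF finite_keys inj])
  moreover have "{k. p k \<noteq> 0} = (\<lambda>k. t + single j k) -` keys f"
    by (auto simp: p_def in_keys_iff)
  ultimately have fin: "finite {k. p k \<noteq> 0}" by simp
  then show "p \<in> laurent" by (simp add: laurent_def)
  have "coeff (laurent_coeff j p * single t 1) a = coeff f a" for a
  proof -
    have "laurent_coeff j p * single t 1 = (\<Sum>k\<in>{k. p k \<noteq> 0}. single (t + single j k) (p k))"
      by (simp add: laurent_coeff_def sum_distrib_right mult_single add.commute)
    then have lhs: "coeff (laurent_coeff j p * single t 1) a = (\<Sum>k\<in>{k. p k \<noteq> 0}. if t + single j k = a then p k else 0)"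
      by (simp add: lookup_sum lookup_single when_def)
    show ?thesis
    proof (cases "omit j a = t")
      case True
      then have a: "t + single j k = a \<longleftrightarrow> k = coeff a j" for k
        using omit_split[of a j] inj by (metis injD)
      then have "coeff f a = p (coeff a j)" by (metis p_def)
      then show ?thesis using lhs fin by (simp add: a)
    next
      case False
      then have "t + single j k \<noteq> a" for k
      proof (rule contrapos_nn)
        assume "t + single j k = a"
        then have "coeff a i = coeff (t + single j k) i" for i by simp
        then show "omit j a = t"
          using assms(2) by (intro poly_mapping_eqI) (simp add: lookup_omit lookup_add lookup_single_not_eq)
      qed
      moreover have "coeff f a = 0" using False assms(1) by (auto simp: in_keys_iff)
      ultimately show ?thesis using lhs by simp
    qed
  qed
  then show "f = laurent_coeff j p * single t 1" by (intro poly_mapping_eqI) simp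
qed

lemma binomial_keys: "keys (single \<alpha> (c::'k::field) - 1) \<subseteq> {\<alpha>, 0}"
  by (auto simp: in_keys_iff lookup_minus lookup_single lookup_one when_def split: if_splits)

lemma single_power:
  obtains \<nu> :: ex where "single \<mu> (c::'k::field) ^ k = single \<nu> (c ^ k)" "\<And>i. coeff \<nu> i = int k * coeff \<mu> i"
proof -
  have "\<exists>\<nu>::ex. single \<mu> c ^ k = single \<nu> (c ^ k) \<and> (\<forall>i. coeff \<nu> i = int k * coeff \<mu> i)"
  proof (induction k)
    case 0
    show ?case by (rule exI[of _ 0]) simp
  next
    case (Suc k)
    then obtain \<nu> :: ex where "single \<mu> c ^ k = single \<nu> (c ^ k)" "\<forall>i. coeff \<nu> i = int k * coeff \<mu> i" by blast
    then show ?case by (intro exI[of _ "\<mu> + \<nu>"]) (simp add: mult_single lookup_add algebra_simps)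
  qed
  then show thesis using that by blast
qed

section \<open>Units, and triples satisfying the relations of x, y and h\<close>

context gwa
begin

lemma hpow_eq: "hpow j m = fa_word (block GH GHi m j)"
  by (simp add: hpow_def block_def fa_gen_eq fa_pow_word)

lemma hmono_eq: "hmono n t = fa_word (blocks GH GHi t [1..<Suc n])"
proof -
  have "foldr (\<lambda>j acc. fa_mult (hpow j (t j)) acc) js fa_one = fa_word (blocks GH GHi t js)" for js
    by (induction js) (simp_all add: fa_one_eq hpow_eq fa_word_mult)
  then show ?thesis by (simp add: hmono_def)
qed

lemma symbol_scal_single: "symbol f = single \<beta> a \<Longrightarrow> symbol (fa_scal c f) = single \<beta> (single 0 c * a)"
  by (rule poly_mapping_eqI) (simp add: lookup_symbol_scal lookup_single when_def)

lemma symbol_hpow: "symbol (hpow j m) = single 0 (single (single j m) 1)"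
  using word_deg_h[of "\<lambda>_. m" "[j]"] word_coeff_h[of "\<lambda>_. m" "[j]"] by (simp add: hpow_eq symbol_word)

lemma hpow_free_alg: "j \<in> {1..n} \<Longrightarrow> hpow j m \<in> free_alg n"
  using over_blocks(1)[of "[j]" n "\<lambda>_. m"] by (simp add: hpow_eq fa_word_free_alg)

lemma symbol_hmono: "t \<in> expo \<Longrightarrow> symbol (hmono n (coeff t)) = single 0 (single t 1)"
  by (simp add: hmono_eq symbol_word word_deg_h word_coeff_h sum_singles_expo)

lemma hmono_free_alg: "hmono n t \<in> free_alg n"
  unfolding hmono_eq by (intro fa_word_free_alg over_blocks(1)) auto

lemma laurent_eval_eq: "laurent_eval p j = (\<Sum>k\<in>{k. p k \<noteq> 0}. fa_scal (p k) (hpow j k))"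
  by (simp add: laurent_eval_def fun_eq_iff sum_fun_apply)

lemma laurent_eval_free_alg: "j \<in> {1..n} \<Longrightarrow> laurent_eval p j \<in> free_alg n"
  unfolding laurent_eval_eq by (intro fa_sum_free_alg fa_scal_free_alg hpow_free_alg)

lemma symbol_laurent_eval: "j \<in> {1..n} \<Longrightarrow> symbol (laurent_eval p j) = single 0 (laurent_coeff j p)"
proof -
  assume "j \<in> {1..n}"
  then have "symbol (laurent_eval p j) = (\<Sum>k\<in>{k. p k \<noteq> 0}. symbol (fa_scal (p k) (hpow j k)))"
    unfolding laurent_eval_eq by (intro symbol_sum fa_scal_free_alg hpow_free_alg)
  also have "\<dots> = (\<Sum>k\<in>{k. p k \<noteq> 0}. single 0 (single (single j k) (p k)))"
    by (rule sum.cong[OF refl]) (simp add: symbol_scal_single[OF symbol_hpow] mult_single)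
  also have "\<dots> = single 0 (laurent_coeff j p)"
    using sum_comp_morphism[of "single 0" "\<lambda>k. single (single j k) (p k)" "{k. p k \<noteq> 0}"]
    by (simp add: laurent_coeff_def single_add comp_def)
  finally show ?thesis .
qed

lemma symbol_gen: "symbol (fa_word [g]) = single (gen_deg g) (gen_coeff g)"
  by (simp add: symbol_word)

lemma vword_single: "j \<in> {1..n} \<Longrightarrow> vword n (single j m) = block GX GY m j"
proof -
  assume j: "j \<in> {1..n}"
  have zero: "blocks GX GY (\<lambda>_. 0) js = []" for js by (induction js) simp_all
  have "blocks GX GY (coeff (single j m)) [1..<j] = []" "blocks GX GY (coeff (single j m)) [Suc j..<Suc n] = []"
    by (subst blocks_cong[where t' = "\<lambda>_. 0"]; simp add: lookup_single_not_eq zero)+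
  then show ?thesis by (simp add: upt_split[OF j])
qed

lemma symbol_keys_expo: "f \<in> free_alg n \<Longrightarrow> keys (symbol f) \<subseteq> expo"
proof -
  assume f: "f \<in> free_alg n"
  have "keys (symbol f) \<subseteq> (\<Union>w\<in>{w. f w \<noteq> 0}. keys (single (word_deg w) (single 0 (f w) * word_coeff w)))"
    unfolding symbol_def by (rule Poly_Mapping.keys_sum)
  also have "\<dots> \<subseteq> expo" using word_deg_expo free_algD(2)[OF f] by (auto split: if_splits)
  finally show ?thesis .
qed

lemma twisted_single:
  assumes "tmult F G = single \<gamma> c" "c \<noteq> 0"
  obtains \<alpha> a \<beta> b where "F = single \<alpha> a" "G = single \<beta> b" "\<alpha> + \<beta> = \<gamma>" "a * twist \<alpha> b = c"
proof (rule twisted_mult_eq_single[OF twist_add _ assms])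
  show "\<And>\<alpha> x. twist \<alpha> x = 0 \<Longrightarrow> x = 0" by (rule twist_eq_0)
qed (rule that)

text \<open>Both factors are single terms in X, and their coefficients are then monomials in h. A
  monomial does not vanish at h_j = 1, whereas the coefficient of a term of negative degree at j
  does; the degrees \<beta> and \<beta>' are opposite, so neither can be nonzero at j.\<close>

lemma unit_symbol:
  assumes "f \<in> free_alg n" "g \<in> free_alg n" "tmult (symbol f) (symbol g) = single 0 1"
  obtains \<mu> \<gamma> where "\<gamma> \<noteq> 0" "symbol f = single 0 (single \<mu> \<gamma>)"
proof -
  obtain \<beta> u \<beta>' v where uv: "symbol f = single \<beta> u" "symbol g = single \<beta>' v" "\<beta> + \<beta>' = 0" "u * twist \<beta> v = 1"
    using assms(3) by (rule twisted_single) simp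
  from uv(4) have "u * twist \<beta> v = single 0 1" by simp
  then obtain \<mu> a \<mu>' b where ab: "u = single \<mu> a" "twist \<beta> v = single \<mu>' b" "a * b = 1"
    by (rule mult_eq_single) simp_all
  have "v = twist (- \<beta>) (single \<mu>' b)" using ab(2) twist_twist[of "- \<beta>" \<beta> v] by simp
  then have v: "v = single \<mu>' (chi (- \<beta>) \<mu>' * b)" by (simp add: twist_single)
  have nz: "a \<noteq> 0" "chi (- \<beta>) \<mu>' * b \<noteq> 0" using ab(3) chi_nonzero by auto
  have "u \<noteq> 0" using uv(4) by auto
  then have "\<beta> \<in> expo" using symbol_keys_expo[OF assms(1)] uv(1) by simp
  have sp: "specialize j 1 (single \<alpha> c) \<noteq> 0" if "c \<noteq> 0" for j \<alpha> and c :: 'k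
    using that by (simp add: specialize_single) (metis lookup_single_eq lookup_zero)
  have "coeff \<beta> j = 0" for j
  proof (rule ccontr)
    assume "coeff \<beta> j \<noteq> 0"
    then have j: "j \<in> {1..n}" using \<open>\<beta> \<in> expo\<close> by (auto simp: expo_def in_keys_iff)
    have "\<beta>' = - \<beta>" using uv(3) by (simp add: eq_neg_iff_add_eq_0 add.commute)
    then consider "coeff \<beta> j < 0" | "coeff \<beta>' j < 0" using \<open>coeff \<beta> j \<noteq> 0\<close> by fastforce
    then show False
    proof cases
      case 1
      then have "specialize j 1 u = 0"
        using specialize_symbol[OF assms(1) j, of 0 \<beta>] uv(1) by simp
      then show False using sp nz ab(1) by simp
    next
      case 2
      then have "specialize j 1 v = 0"
        using specialize_symbol[OF assms(2) j, of 0 \<beta>'] uv(2) by simp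
      then show False using sp nz v by simp
    qed
  qed
  then have "\<beta> = 0" by (intro poly_mapping_eqI) simp
  then show thesis using that nz(1) uv(1) ab(1) by simp
qed

text \<open>\<open>X\<close>, \<open>Y\<close>, \<open>H\<close> are the images of \<open>x\<^sub>i\<close>, \<open>y\<^sub>i\<close>, \<open>h\<^sub>i\<close> and \<open>e\<close> is the parameter \<open>q\<^sub>i\<close> of the source.\<close>

lemma triple_symbol:
  fixes SX SY :: "ex \<Rightarrow>\<^sub>0 'k lau"
  assumes free: "X \<in> free_alg n" "Y \<in> free_alg n"
    and H: "symbol H = single 0 (single \<mu> \<gamma>)" "\<gamma> \<noteq> 0"
    and e: "e \<noteq> 0" "e ^ d \<noteq> 1"
    and XH: "\<And>\<beta>. coeff (tmult (symbol X) (symbol H)) \<beta> = single 0 e * coeff (tmult (symbol H) (symbol X)) \<beta>"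
    and XY: "tmult (symbol X) (symbol Y) = single 0 (single 0 (e ^ d) * single \<mu> \<gamma> ^ d - 1)"
    and YX: "tmult (symbol Y) (symbol X) = single 0 (single \<mu> \<gamma> ^ d - 1)"
  obtains j m F G and s :: int
    where "j \<in> {1..n}" "m \<noteq> 0" "\<mu> = single j m" "s = 1 \<and> \<gamma> ^ d = 1 \<or> s = -1 \<and> e ^ d * \<gamma> ^ d = 1" "e = q j powi (s * m)"
      "symbol X = single (single j s) F" "symbol Y = single (single j (-s)) G"
      "F * twist (single j s) G = single (single j (m * int d)) ((e * \<gamma>) ^ d) - 1"
proof -
  define E where "E = single 0 (e ^ d) * single \<mu> \<gamma> ^ d - 1"
  obtain \<nu> where \<nu>: "single \<mu> \<gamma> ^ d = single \<nu> (\<gamma> ^ d)" "\<And>i. coeff \<nu> i = int d * coeff \<mu> i"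
    using single_power[of \<mu> \<gamma> d] by blast
  have E: "E = single \<nu> ((e * \<gamma>) ^ d) - 1" by (simp add: E_def \<nu> mult_single power_mult_distrib)
  have "e \<noteq> 1" using e(2) by auto
  \<comment> \<open>Otherwise H is a scalar and commutes with X, so that e \<noteq> 1 forces X = 0.
    The two vanishing products then give (e \<gamma>)^d = 1 = \<gamma>^d, against e^d \<noteq>
    1.\<close>
  have "\<mu> \<noteq> 0"
  proof
    assume \<mu>: "\<mu> = 0"
    have "symbol X = 0"
    proof (rule poly_mapping_eqI)
      fix \<beta>
      have "coeff (tmult F (single 0 (single 0 \<gamma>))) \<beta> = coeff F \<beta> * single 0 \<gamma>"
        "coeff (tmult (single 0 (single 0 \<gamma>)) F) \<beta> = single 0 \<gamma> * coeff F \<beta>" for F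
        by (induction F rule: pm_induct; simp add: twisted_mult_add_left twisted_mult_add_right
            twisted_mult_single lookup_add lookup_single when_def twist_single distrib_left distrib_right)+
      note XH' = this[of "symbol X"]
      have "(1 - single 0 e) * (single 0 \<gamma> * coeff (symbol X) \<beta>) = 0"
        using XH[of \<beta>] unfolding H(1) \<mu> XH' by (simp add: algebra_simps)
      moreover have "1 - single 0 e \<noteq> (0 :: 'k lau)" using \<open>e \<noteq> 1\<close> single_eq_one(2)[of 0 e] by auto
      moreover have "single 0 \<gamma> \<noteq> (0 :: 'k lau)" using H(2) by (metis lookup_single_eq lookup_zero)
      ultimately show "coeff (symbol X) \<beta> = coeff 0 \<beta>" by simp
    qed
    then have "single 0 E = (0 :: ex \<Rightarrow>\<^sub>0 'k lau)" "single 0 (single \<mu> \<gamma> ^ d - 1) = (0 :: ex \<Rightarrow>\<^sub>0 'k lau)"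
      using XY YX by (simp_all add: E_def)
    then have "E = 0" "single \<mu> \<gamma> ^ d - 1 = 0" by (metis lookup_single_eq lookup_zero)+
    then have "single \<nu> ((e * \<gamma>) ^ d) = 1" "single \<nu> (\<gamma> ^ d) = 1" by (simp_all add: E \<nu>(1))
    then have "(e * \<gamma>) ^ d = 1" "\<gamma> ^ d = 1" using single_eq_one(2) by blast+
    then show False using e(2) by (simp add: power_mult_distrib)
  qed
  have "\<nu> \<noteq> 0"
  proof
    assume "\<nu> = 0"
    then have "coeff \<mu> i = 0" for i using \<nu>(2)[of i] d_pos by simp
    then have "\<mu> = 0" by (intro poly_mapping_eqI) simp
    with \<open>\<mu> \<noteq> 0\<close> show False ..
  qed
  then have "E \<noteq> 0" unfolding E by (rule binomial_nonzero)
  obtain \<alpha> F \<alpha>' G where FG: "symbol X = single \<alpha> F" "symbol Y = single \<alpha>' G" "\<alpha> + \<alpha>' = 0" "F * twist \<alpha> G = E"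
    using XY \<open>E \<noteq> 0\<close> unfolding E_def[symmetric] by (rule twisted_single)
  have \<alpha>': "\<alpha>' = - \<alpha>" using FG(3) by (simp add: eq_neg_iff_add_eq_0 add.commute)
  have "F \<noteq> 0" using FG(4) \<open>E \<noteq> 0\<close> by auto
  have "\<alpha> \<in> expo" using symbol_keys_expo[OF free(1)] FG(1) \<open>F \<noteq> 0\<close> by simp
  have "F * single \<mu> (chi \<alpha> \<mu> * \<gamma>) = single 0 e * (single \<mu> \<gamma> * F)"
    using XH[of \<alpha>] by (simp add: H FG(1) twisted_mult_single twist_single)
  then have "F * single \<mu> (chi \<alpha> \<mu> * \<gamma>) = F * single \<mu> (e * \<gamma>)"
    by (simp add: mult_single mult_ac)
  then have "single \<mu> (chi \<alpha> \<mu> * \<gamma>) = single \<mu> (e * \<gamma>)" using \<open>F \<noteq> 0\<close> by simp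
  then have chi: "chi \<alpha> \<mu> = e" using H(2) by (metis lookup_single_eq mult_right_cancel)
  \<comment> \<open>Evaluating h_i in a binomial c h^\<nu> - 1 leaves another such binomial; it
    vanishes only if no other variable survives and the scalar is 1.\<close>
  have root: "omit i \<nu> = 0 \<and> a powi coeff \<nu> i * (e * \<gamma>) ^ d = 1" if "specialize i a E = 0" for i a
  proof -
    have "single (omit i \<nu>) (a powi coeff \<nu> i * (e * \<gamma>) ^ d) = 1"
      using that by (simp add: E specialize_diff specialize_single)
    then show ?thesis using single_eq_one by blast
  qed
  have neg: "specialize i (q i powi k) E = 0" if "i \<in> {1..n}" "0 \<le> k" "k < - coeff \<alpha> i" for i k
    using specialize_symbol[OF free(1) that] q_nonzero[OF that(1)]
    by (simp add: FG(1) specialize_mult flip: FG(4))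
  \<comment> \<open>For positive \<alpha>_i the roots come from G, whose degree is -\<alpha>.
    Twisting by X^\<alpha> moves its roots q_i^0, ..., q_i^(\<alpha>_i - 1) to q_i^(-\<alpha>_i),
    ..., q_i^(-1).\<close>
  have pos: "specialize i (q i powi (-k)) E = 0" if "i \<in> {1..n}" "1 \<le> k" "k \<le> coeff \<alpha> i" for i k
  proof -
    have "specialize i (q i powi (coeff \<alpha> i - k)) G = 0"
      using specialize_symbol[OF free(2) that(1), of "coeff \<alpha> i - k" \<alpha>'] that by (simp add: FG(2) \<alpha>')
    then have "specialize i (q i powi (-k)) (twist \<alpha> G) = 0"
      using q_nonzero[OF that(1)] specialize_twist[OF that(1), of "q i powi (-k)" \<alpha> G]
      by (simp flip: power_int_add)
    then show ?thesis using q_nonzero[OF that(1)] by (simp add: specialize_mult flip: FG(4))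
  qed
  \<comment> \<open>Either sign of \<alpha>_i provides at least one root.\<close>
  have supp: "omit i \<nu> = 0" if "i \<in> {1..n}" "coeff \<alpha> i \<noteq> 0" for i
    using that(2) root[OF neg[OF that(1), of 0]] root[OF pos[OF that(1), of 1]] by linarith
  have "\<alpha> \<noteq> 0" using chi \<open>e \<noteq> 1\<close> by auto
  then obtain j where "coeff \<alpha> j \<noteq> 0" by (metis lookup_zero poly_mapping_eqI)
  then have j: "j \<in> {1..n}" using \<open>\<alpha> \<in> expo\<close> by (auto simp: expo_def in_keys_iff)
  have "coeff \<mu> i = 0" if "i \<noteq> j" for i
    using supp[OF j \<open>coeff \<alpha> j \<noteq> 0\<close>] lookup_omit[of j \<nu> i] that \<nu>(2)[of i] d_pos by simp
  then have \<mu>: "\<mu> = single j (coeff \<mu> j)"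
    by (intro poly_mapping_eqI) (auto simp: lookup_single when_def)
  define m s where "m = coeff \<mu> j" and "s = coeff \<alpha> j"
  have m: "m \<noteq> 0" using \<mu> \<open>\<mu> \<noteq> 0\<close> by (auto simp: m_def)
  have \<nu>': "\<nu> = single j (m * int d)"
    by (rule poly_mapping_eqI) (subst \<nu>(2), subst \<mu>, simp add: lookup_single when_def m_def)
  \<comment> \<open>A second index in the support of \<alpha> would confine \<nu> to that index, but
    its coordinate at j is m d \<noteq> 0.\<close>
  have "coeff \<alpha> i = 0" if "i \<noteq> j" for i
  proof (rule ccontr)
    assume i: "coeff \<alpha> i \<noteq> 0"
    then have "i \<in> {1..n}" using \<open>\<alpha> \<in> expo\<close> by (auto simp: expo_def in_keys_iff)
    from supp[OF this i] have "coeff (omit i \<nu>) j = 0" by simp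
    then show False using that m d_pos by (simp add: lookup_omit \<nu>')
  qed
  then have \<alpha>: "\<alpha> = single j s" by (intro poly_mapping_eqI) (auto simp: lookup_single when_def s_def)
  have e_eq: "e = q j powi (s * m)" using chi \<mu> j by (simp add: \<alpha> chi_single_left m_def)
  let ?Q = "q j powi (m * int d)"
  have q0: "q j \<noteq> 0" by (rule q_nonzero[OF j])
  have ed: "e ^ d = ?Q powi s"
    by (simp add: e_eq mult_ac flip: power_int_mult power_int_of_nat)
  \<comment> \<open>With Q = q_j^(m d), the |s| roots become |s| consecutive integers k satisfying
    Q^k (e \<gamma>)^d = 1. Two of them would give Q = 1, impossible since e^d = Q^s.\<close>
  have rt: "?Q powi k * (e * \<gamma>) ^ d = 1" if "0 \<le> k \<and> k < - s \<or> 1 \<le> - k \<and> - k \<le> s" for k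
  proof -
    have "(q j powi k) powi coeff \<nu> j * (e * \<gamma>) ^ d = 1"
      using that root[OF neg[OF j, of k]] root[OF pos[OF j, of "-k"]] by (auto simp: s_def)
    then show ?thesis by (simp add: \<nu>' mult_ac flip: power_int_mult)
  qed
  have Q1: "?Q \<noteq> 1" using ed e(2) by auto
  have "s \<noteq> 0" using \<open>coeff \<alpha> j \<noteq> 0\<close> by (simp add: s_def)
  have "\<not> s \<le> -2"
  proof
    assume "s \<le> -2"
    then have "?Q powi 0 * (e * \<gamma>) ^ d = 1" "?Q powi 1 * (e * \<gamma>) ^ d = 1" by (intro rt; simp)+
    then show False using Q1 by simp
  qed
  moreover have "\<not> 2 \<le> s"
  proof
    assume "2 \<le> s"
    then have *: "?Q powi (-1) * (e * \<gamma>) ^ d = 1" "?Q powi (-2) * (e * \<gamma>) ^ d = 1" by (intro rt; simp)+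
    have "?Q powi (-1) = ?Q powi 1 * ?Q powi (-2)" using power_int_add[of ?Q 1 "-2"] q0 by simp
    with * show False using Q1 by (metis mult.assoc mult_1_right power_int_1_right)
  qed
  ultimately consider "s = 1" | "s = -1" using \<open>s \<noteq> 0\<close> by linarith
  \<comment> \<open>The single root is at k = -1 for s = 1 and at k = 0 for s = -1; combined with
    e^d = Q^s it yields the value of \<gamma>^d in (iv).\<close>
  then have "s = 1 \<and> \<gamma> ^ d = 1 \<or> s = -1 \<and> e ^ d * \<gamma> ^ d = 1"
  proof cases
    case 1
    have "?Q powi (-1) * (e * \<gamma>) ^ d = 1" by (rule rt) (simp add: 1)
    moreover have "inverse ?Q * (?Q * \<gamma> ^ d) = \<gamma> ^ d" using q0 by (simp flip: mult.assoc)
    ultimately show ?thesis using 1 ed by (simp add: power_mult_distrib power_int_minus)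
  next
    case 2
    have "?Q powi 0 * (e * \<gamma>) ^ d = 1" by (rule rt) (simp add: 2)
    then show ?thesis using 2 by (simp add: power_mult_distrib)
  qed
  then show thesis
  proof (rule that[OF j m, rotated 1])
    show "\<mu> = single j m" using \<mu> by (simp only: m_def)
    show "e = q j powi (s * m)" by (rule e_eq)
    show "symbol X = single (single j s) F" using FG(1) by (simp only: \<alpha>)
    show "symbol Y = single (single j (-s)) G" using FG(2) by (simp only: \<alpha>' \<alpha> single_uminus)
    show "F * twist (single j s) G = single (single j (m * int d)) ((e * \<gamma>) ^ d) - 1"
      using FG(4) by (simp only: E \<nu>' \<alpha>)
  qed
qed

text \<open>Carries the torus description back to A. Divisibility by the normal words turns the
  product XY into f g1 R = E, with R and E binomials in h_j alone; homogeneity then splits f and g1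
  into polynomials in h_j and opposite monomials in the other variables.\<close>

lemma triple_form:
  assumes free: "X \<in> free_alg n" "Y \<in> free_alg n" "H \<in> free_alg n"
    and H: "symbol H = single 0 (single \<mu> \<gamma>)" "\<gamma> \<noteq> 0"
    and e: "e \<noteq> 0" "e ^ d \<noteq> 1"
    and XH: "\<And>\<beta>. coeff (tmult (symbol X) (symbol H)) \<beta> = single 0 e * coeff (tmult (symbol H) (symbol X)) \<beta>"
    and XY: "tmult (symbol X) (symbol Y) = single 0 (single 0 (e ^ d) * single \<mu> \<gamma> ^ d - 1)"
    and YX: "tmult (symbol Y) (symbol X) = single 0 (single \<mu> \<gamma> ^ d - 1)"
  obtains j m t p p' F and \<tau> :: int
    where "j \<in> {1..n}" "\<tau> \<in> {0, 1}" "m \<noteq> 0" "p \<in> laurent" "p' \<in> laurent"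
      "symbol H = single 0 (single (single j m) \<gamma>)"
      "q j powi ((-1) ^ nat \<tau> * m) = e" "\<gamma> ^ d = e powi (- (\<tau> * int d))"
      "fa_mult (laurent_eval p j) (fa_mult (laurent_eval p' j)
         (fa_diff (fa_scal (q j powi ((1 - \<tau>) * int d)) (hpow j (int d))) fa_one))
       \<approx> fa_diff (fa_scal ((e * \<gamma>) ^ d) (hpow j (m * int d))) fa_one"
      "H \<approx> fa_scal \<gamma> (hpow j m)"
      "X \<approx> fa_mult (laurent_eval p j) (fa_mult (hmono n (coeff t)) (fa_gen (if \<tau> = 0 then GX j else GY j)))"
      "Y \<approx> fa_mult (fa_gen (if \<tau> = 0 then GY j else GX j)) (fa_mult (laurent_eval p' j) (hmono n (\<lambda>i. - coeff t i)))"
      "coeff t j = 0" "symbol X = single (single j (1 - 2 * \<tau>)) F" "F \<noteq> 0" "\<And>a. a \<in> keys F \<Longrightarrow> omit j a = t"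
proof -
  obtain j m F G and s :: int where j: "j \<in> {1..n}" and m: "m \<noteq> 0" and \<mu>: "\<mu> = single j m"
    and s: "s = 1 \<and> \<gamma> ^ d = 1 \<or> s = -1 \<and> e ^ d * \<gamma> ^ d = 1" and e_eq: "e = q j powi (s * m)"
    and SX: "symbol X = single (single j s) F" and SY: "symbol Y = single (single j (-s)) G"
    and FG: "F * twist (single j s) G = single (single j (m * int d)) ((e * \<gamma>) ^ d) - 1"
    by (rule triple_symbol[OF free(1,2) H e XH XY YX])
  define E where "E = single (single j (m * int d)) ((e * \<gamma>) ^ d) - 1"
  define \<tau> where "\<tau> = (if s = 1 then 0 else 1 :: int)"
  define v v' where "v = (if \<tau> = 0 then GX j else GY j)" and "v' = (if \<tau> = 0 then GY j else GX j)"
  \<comment> \<open>The torus value of v v', namely x_j y_j or y_j x_j; it is the factor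
    a_d(q^(1-\<tau>) h) of (iii).\<close>
  define R where "R = single (single j (int d)) (q j powi ((1 - \<tau>) * int d)) - 1"
  have s\<tau>: "s = 1 - 2 * \<tau>" using s by (auto simp: \<tau>_def)
  have deg: "gen_deg v = single j s" "gen_deg v' = single j (-s)" and idx: "over n [v]" "over n [v']"
    using s j by (auto simp: v_def v'_def \<tau>_def)
  have blk: "block GX GY s j = [v]" "block GX GY (-s) j = [v']"
    using s by (auto simp: block_def v_def v'_def \<tau>_def)
  have R: "gen_coeff v * twist (single j s) (gen_coeff v') = R"
    using s j by (auto simp: v_def v'_def \<tau>_def R_def twist_diff twist_single chi_single_left)
  have "single j (k * int d) \<noteq> 0" if "k \<noteq> 0" for k
    using that d_pos by (metis lookup_single_eq lookup_zero mult_eq_0_iff not_one_le_zero of_nat_eq_0_iff)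
  from this[OF m] this[of 1] have "E \<noteq> 0" "R \<noteq> 0" unfolding E_def R_def using binomial_nonzero by auto
  obtain f where f: "keys f \<subseteq> expo" "F = f * gen_coeff v"
    using symbol_divisible[OF free(1), of "single j s"] by (auto simp: SX vword_single[OF j] blk)
  obtain g where g: "G = g * gen_coeff v'"
    using symbol_divisible[OF free(2), of "single j (-s)"] by (auto simp: SY vword_single[OF j] blk)
  \<comment> \<open>Divisibility puts the cofactor g to the left of v', while the conclusion wants
    it on the right; moving it across v' is the twist by the degree of v.\<close>
  define g1 where "g1 = twist (single j s) g"
  have E: "(f * g1) * R = E"
    using FG by (simp add: E_def g1_def f g twist_mult mult_ac flip: R)
  have "F \<noteq> 0" using FG \<open>E \<noteq> 0\<close> unfolding E_def by auto
  have omit_bin: "omit j a = 0" if "a \<in> keys (single (single j k) (c::'k) - 1)" for a k c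
    using binomial_keys[of "single j k" c] that by (auto simp: omit_single)
  have E_keys: "omit j a = 0" if "a \<in> keys ((f * g1) * R)" for a
    using that omit_bin unfolding E E_def by blast
  \<comment> \<open>The grading used here records the exponents of all variables except h_j. R and E
    are nonzero of degree 0, hence so is f g1, and its factors have opposite degrees.\<close>
  obtain \<epsilon> \<delta> where \<epsilon>: "\<epsilon> + \<delta> = 0" "\<And>a. a \<in> keys (f * g1) \<Longrightarrow> omit j a = \<epsilon>" "\<And>a. a \<in> keys R \<Longrightarrow> omit j a = \<delta>"
    using factors_homogeneous[of "omit j" "f * g1" R 0] omit_add E_keys E \<open>E \<noteq> 0\<close> by metis
  have "keys R \<noteq> {}" using \<open>R \<noteq> 0\<close> by simp
  then have "\<delta> = 0" using \<epsilon>(3) omit_bin unfolding R_def by blast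
  then have fg_keys: "omit j a = 0" if "a \<in> keys (f * g1)" for a using \<epsilon> that by simp
  have "f * g1 \<noteq> 0" using E \<open>E \<noteq> 0\<close> by auto
  then obtain t t' where t: "t + t' = 0" "\<And>a. a \<in> keys f \<Longrightarrow> omit j a = t" "\<And>a. a \<in> keys g1 \<Longrightarrow> omit j a = t'"
    using factors_homogeneous[of "omit j" f g1 0] omit_add fg_keys by metis
  have t': "t' = - t" using t(1) by (simp add: eq_neg_iff_add_eq_0 add.commute)
  \<comment> \<open>One key of f suffices to see that t avoids j and is supported in 1..n, as
    \<open>hmono\<close> requires.\<close>
  obtain a where a: "a \<in> keys f" using \<open>f * g1 \<noteq> 0\<close> by (metis mult_zero_left keys_eq_empty ex_in_conv)
  then have tj: "coeff t j = 0" using t(2) lookup_omit by metis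
  have "keys (omit j a) \<subseteq> keys a" by (auto simp: in_keys_iff lookup_omit split: if_splits)
  then have t_expo: "t \<in> expo" using f(1) a t(2)[OF a] by (auto simp: expo_def)
  then have t'_expo: "- t \<in> expo" by (simp add: expo_def)
  obtain p where p: "p \<in> laurent" "f = laurent_coeff j p * single t 1"
    by (rule homogeneous_eq_laurent[OF t(2) tj])
  have tj': "coeff (- t) j = 0" using tj by simp
  obtain p' where p': "p' \<in> laurent" "g1 = laurent_coeff j p' * single (- t) 1"
    using homogeneous_eq_laurent[OF t(3) tj'[folded t']] unfolding t' by blast
  have neg_t: "(\<lambda>i. - coeff t i) = coeff (- t)" by (simp add: fun_eq_iff)
  note free_algs = laurent_eval_free_alg[OF j] hpow_free_alg[OF j] hmono_free_alg fa_scal_free_alg fa_mult_free_alg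
    fa_diff_free_alg fa_word_free_alg[OF idx(1)] fa_word_free_alg[OF idx(2)] fa_word_free_alg[of n "[]"]
  note symbols = symbol_mult symbol_diff symbol_laurent_eval[OF j] symbol_scal_single[OF symbol_hpow] symbol_gen
    symbol_hmono[OF t_expo] symbol_hmono[OF t'_expo] symbol_word twisted_mult_single
  show thesis
  proof (rule that[OF j _ m p(1) p'(1)])
    show "\<tau> \<in> {0, 1}" by (simp add: \<tau>_def)
    show "symbol H = single 0 (single (single j m) \<gamma>)" using H(1) \<mu> by simp
    show "q j powi ((-1) ^ nat \<tau> * m) = e" using s by (auto simp: e_eq \<tau>_def)
    show "\<gamma> ^ d = e powi (- (\<tau> * int d))"
      using s by (auto simp: \<tau>_def power_int_minus inverse_eq_divide nonzero_eq_divide_eq e(1) mult.commute)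
    have "f * g1 = laurent_coeff j p * laurent_coeff j p' * (single t 1 * single (- t) 1)"
      unfolding p(2) p'(2) by (simp only: mult_ac)
    then have "laurent_coeff j p * (laurent_coeff j p' * R) = E"
      using E by (simp add: mult_single mult.assoc)
    then show "fa_mult (laurent_eval p j) (fa_mult (laurent_eval p' j)
         (fa_diff (fa_scal (q j powi ((1 - \<tau>) * int d)) (hpow j (int d))) fa_one))
       \<approx> fa_diff (fa_scal ((e * \<gamma>) ^ d) (hpow j (m * int d))) fa_one"
      by (intro eqA_if_symbol_eq)
        (simp_all add: fa_diff_eq fa_one_eq free_algs symbols mult_single R_def E_def flip: single_diff single_one)
    show "H \<approx> fa_scal \<gamma> (hpow j m)"
      by (intro eqA_if_symbol_eq free_algs free) (simp add: symbols H(1) \<mu> mult_single)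
    show "X \<approx> fa_mult (laurent_eval p j) (fa_mult (hmono n (coeff t)) (fa_gen (if \<tau> = 0 then GX j else GY j)))"
      unfolding v_def[symmetric] fa_gen_eq
      by (intro eqA_if_symbol_eq free_algs free) (simp add: free_algs symbols SX deg f(2) p(2) mult.assoc)
    have "G = gen_coeff v' * twist (single j (-s)) g1"
      by (simp add: g g1_def twist_twist single_add_same mult.commute)
    then show "Y \<approx> fa_mult (fa_gen (if \<tau> = 0 then GY j else GX j)) (fa_mult (laurent_eval p' j) (hmono n (\<lambda>i. - coeff t i)))"
      unfolding v'_def[symmetric] fa_gen_eq neg_t
      by (intro eqA_if_symbol_eq free_algs free) (simp add: free_algs symbols SY deg p'(2))
    show "coeff t j = 0" by (rule tj)
    show "symbol X = single (single j (1 - 2 * \<tau>)) F" using SX s\<tau> by simp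
    show "F \<noteq> 0" by fact
    \<comment> \<open>The coefficient of v involves only h_j, so F has the same degree t as f away
      from j. The commutation relations (ii) are read off from this.\<close>
    show "omit j b = t" if in_F: "b \<in> keys F" for b
    proof -
      obtain b1 b2 where b: "b = b1 + b2" "b1 \<in> keys f" "b2 \<in> keys (gen_coeff v)"
        using in_F keys_mult[of f "gen_coeff v"] unfolding f(2) by blast
      have "omit j b2 = 0" using b(3) omit_bin by (auto simp: v_def split: if_splits)
      then show ?thesis using t(2)[OF b(2)] by (simp add: b(1) omit_add)
    qed
  qed
qed

text \<open>On elements homogeneous in h_j, conjugation by a power of X_j is multiplication by a
  scalar.\<close>

lemma twist_homogeneous:
  assumes "j \<in> {1..n}" "\<And>a. a \<in> keys F \<Longrightarrow> coeff a j = k"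
  shows "twist (single j s) F = single 0 (q j powi (s * k)) * F"
proof (rule poly_mapping_eqI)
  fix a
  have "coeff (single 0 c * F) a = c * coeff F a" for c
    by (induction F rule: pm_induct) (auto simp: mult_single distrib_left lookup_add lookup_single when_def)
  then show "coeff (twist (single j s) F) a = coeff (single 0 (q j powi (s * k)) * F) a"
    using assms(2)[of a] by (cases "a \<in> keys F") (auto simp: lookup_twist chi_single_left[OF assms(1)] in_keys_iff)
qed

end

section \<open>Transport of the source relations into the torus of the target\<close>

locale gwa_hom = gwa n d q + source: gwa r d qt
  for n r d :: nat and q qt :: "nat \<Rightarrow> 'k::field" +
  fixes Psi :: "'k fa \<Rightarrow> 'k fa"
  assumes hom: "alg_hom r qt n q d Psi"
    and qt_root: "i \<in> {1..r} \<Longrightarrow> qt i ^ d \<noteq> 1"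
begin

lemma Psi_free_alg: "f \<in> free_alg r \<Longrightarrow> Psi f \<in> free_alg n"
  using hom by (simp add: alg_hom_def)

lemma Psi_mult: "f \<in> free_alg r \<Longrightarrow> g \<in> free_alg r \<Longrightarrow> Psi (fa_mult f g) = fa_mult (Psi f) (Psi g)"
  using hom by (simp add: alg_hom_def)

lemma Psi_scal: "f \<in> free_alg r \<Longrightarrow> Psi (fa_scal c f) = fa_scal c (Psi f)"
  using hom by (simp add: alg_hom_def)

lemma Psi_Nil: "Psi (fa_word []) = fa_word []"
  using hom by (simp add: alg_hom_def fa_one_eq)

lemma Psi_add: "f \<in> free_alg r \<Longrightarrow> g \<in> free_alg r \<Longrightarrow> Psi (f + g) = Psi f + Psi g"
  using hom by (simp add: alg_hom_def fa_add_eq)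

lemma Psi_diff: "f \<in> free_alg r \<Longrightarrow> g \<in> free_alg r \<Longrightarrow> Psi (f - g) = Psi f - Psi g"
  using Psi_add[of "f - g" g] by (simp add: fa_diff_free_alg)

definition img :: "'k fa \<Rightarrow> ex \<Rightarrow>\<^sub>0 'k lau" where
  "img f = symbol (Psi f)"

lemma img_cong: "eqA r d qt f g \<Longrightarrow> f \<in> free_alg r \<Longrightarrow> g \<in> free_alg r \<Longrightarrow> img f = img g"
proof -
  assume fg: "f \<in> free_alg r" "g \<in> free_alg r" and "eqA r d qt f g"
  then have "Psi (f - g) \<in> rel_ideal n d q"
    using hom by (simp add: alg_hom_def eqA_def fa_diff_eq)
  then show ?thesis
    unfolding img_def by (intro symbol_cong Psi_free_alg fg) (simp add: eqA_def fa_diff_eq Psi_diff fg)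
qed

lemma img_word_append: "over r u \<Longrightarrow> over r v \<Longrightarrow> img (fa_word (u @ v)) = tmult (img (fa_word u)) (img (fa_word v))"
  by (simp add: img_def Psi_mult fa_word_free_alg Psi_free_alg flip: symbol_mult fa_word_mult)

lemma img_word_pair: "over r [a, b] \<Longrightarrow> img (fa_word [a, b]) = tmult (img (fa_word [a])) (img (fa_word [b]))"
  using img_word_append[of "[a]" "[b]"] by simp

lemma img_Nil: "img (fa_word []) = single 0 1"
  by (simp add: img_def Psi_Nil symbol_word)

lemma img_scal: "f \<in> free_alg r \<Longrightarrow> coeff (img (fa_scal c f)) \<beta> = single 0 c * coeff (img f) \<beta>"
  by (simp add: img_def Psi_scal lookup_symbol_scal)

lemma img_diff: "f \<in> free_alg r \<Longrightarrow> g \<in> free_alg r \<Longrightarrow> img (f - g) = img f - img g"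
  by (simp add: img_def Psi_diff symbol_diff Psi_free_alg)

lemma img_commute:
  assumes "gidx a \<in> {1..r}" "gidx b \<in> {1..r}" "gidx a \<noteq> gidx b"
  shows "tmult (img (fa_word [a])) (img (fa_word [b])) = tmult (img (fa_word [b])) (img (fa_word [a]))"
  using img_cong[OF source.eqA_commute[OF assms]] assms by (simp add: img_word_pair fa_word_free_alg)

text \<open>Since h_i is a unit, its image is a monomial c h^\<mu>; the remaining relations of x_i,
  y_i, h_i then become the hypotheses of \<open>triple_symbol\<close>.\<close>

lemma img_triple:
  assumes i: "i \<in> {1..r}"
  obtains \<mu> \<gamma> where "\<gamma> \<noteq> 0" "img (fa_word [GH i]) = single 0 (single \<mu> \<gamma>)"
    "\<And>\<beta>. coeff (tmult (img (fa_word [GX i])) (img (fa_word [GH i]))) \<beta> =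
      single 0 (qt i) * coeff (tmult (img (fa_word [GH i])) (img (fa_word [GX i]))) \<beta>"
    "tmult (img (fa_word [GX i])) (img (fa_word [GY i])) = single 0 (single 0 (qt i ^ d) * single \<mu> \<gamma> ^ d - 1)"
    "tmult (img (fa_word [GY i])) (img (fa_word [GX i])) = single 0 (single \<mu> \<gamma> ^ d - 1)"
proof -
  note rel = source.eqA_rels[OF i]
  have ov: "over r [GH i]" "over r [GHi i]" "over r [GX i]" "over r [GY i]" "over r (replicate k (GH i))" for k
    using i by (simp_all add: over_replicate)
  note free = fa_word_free_alg[of r] fa_scal_free_alg fa_diff_free_alg
  have "tmult (img (fa_word [GH i])) (img (fa_word [GHi i])) = single 0 1"
    using img_cong[OF rel(1)] ov by (simp add: img_word_pair free img_Nil)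
  moreover have "Psi (fa_word [GH i]) \<in> free_alg n" "Psi (fa_word [GHi i]) \<in> free_alg n"
    by (intro Psi_free_alg free ov)+
  ultimately obtain \<mu> \<gamma> where H: "\<gamma> \<noteq> 0" "img (fa_word [GH i]) = single 0 (single \<mu> \<gamma>)"
    using unit_symbol[of "Psi (fa_word [GH i])" "Psi (fa_word [GHi i])"] unfolding img_def by blast
  have pow: "img (fa_word (replicate k (GH i))) = single 0 (single \<mu> \<gamma> ^ k)" for k
  proof (induction k)
    case (Suc k)
    then show ?case using img_word_append[OF ov(1,5), of k] by (simp add: H(2) twisted_mult_single)
  qed (simp add: img_Nil)
  have scal: "img (fa_scal c (fa_word (replicate d (GH i))) - fa_word []) = single 0 (single 0 c * single \<mu> \<gamma> ^ d - 1)" for c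
  proof -
    have "img (fa_scal c (fa_word (replicate d (GH i)))) = single 0 (single 0 c * single \<mu> \<gamma> ^ d)"
      by (rule poly_mapping_eqI) (simp add: img_scal free ov pow lookup_single when_def)
    then show ?thesis by (simp add: img_diff free ov img_Nil single_diff)
  qed
  show thesis
  proof (rule that[OF H])
    have "img (fa_word [GX i, GH i]) = img (fa_scal (qt i) (fa_word [GH i, GX i]))"
      using i by (intro img_cong[OF rel(3)] free) simp_all
    then show "coeff (tmult (img (fa_word [GX i])) (img (fa_word [GH i]))) \<beta> =
      single 0 (qt i) * coeff (tmult (img (fa_word [GH i])) (img (fa_word [GX i]))) \<beta>" for \<beta>
      using i img_scal[of "fa_word [GH i, GX i]" "qt i" \<beta>] by (simp add: img_word_pair free)
    have "img (fa_word [GX i, GY i]) = img (fa_scal (qt i ^ d) (fa_word (replicate d (GH i))) - fa_word [])"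
      using i ov by (intro img_cong[OF rel(5)] free) simp_all
    then show "tmult (img (fa_word [GX i])) (img (fa_word [GY i])) = single 0 (single 0 (qt i ^ d) * single \<mu> \<gamma> ^ d - 1)"
      using i by (simp add: scal img_word_pair)
    have "img (fa_word [GY i, GX i]) = img (fa_scal 1 (fa_word (replicate d (GH i))) - fa_word [])"
      using i ov by (intro img_cong[OF rel(6)] free) simp_all
    then show "tmult (img (fa_word [GY i])) (img (fa_word [GX i])) = single 0 (single \<mu> \<gamma> ^ d - 1)"
      using i by (simp only: scal) (simp add: img_word_pair)
  qed
qed

end

theorem theorem3p1:
  fixes q qt :: "nat \<Rightarrow> 'k::field" and n r d :: nat and Psi :: "'k fa \<Rightarrow> 'k fa"
  assumes "d \<ge> 1" and "0 < r" and "r \<le> n"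
    and "\<forall>i\<in>{1..n}. q i \<noteq> 0 \<and> q i ^ d \<noteq> 1"
    and "\<forall>i\<in>{1..r}. qt i \<noteq> 0 \<and> qt i ^ d \<noteq> 1"
    and "alg_hom r qt n q d Psi"
  shows "\<exists>(w :: nat \<Rightarrow> nat) (\<tau> :: nat \<Rightarrow> int) (m :: nat \<Rightarrow> int) (\<gamma> :: nat \<Rightarrow> 'k) (b :: nat \<Rightarrow> 'k)
           (t :: nat \<Rightarrow> nat \<Rightarrow> int) (p :: nat \<Rightarrow> int \<Rightarrow> 'k) (p' :: nat \<Rightarrow> int \<Rightarrow> 'k).
     inj_on w {1..r} \<and> w ` {1..r} \<subseteq> {1..n} \<and>
     (\<forall>i\<in>{1..r}. \<tau> i \<in> {0, 1} \<and> m i \<noteq> 0 \<and> \<gamma> i \<noteq> 0 \<and> b i \<noteq> 0 \<and>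
                  p i \<in> laurent \<and> p' i \<in> laurent) \<and>
     (\<forall>i\<in>{1..r}. q (w i) powi ((-1) ^ nat (\<tau> i) * m i) = qt i) \<and>
     (\<forall>i\<in>{1..r}. \<forall>l\<in>{1..r}.
        q (w i) powi (t l (w i) * (1 - \<tau> i)) * q (w i) powi (- t l (w i) * \<tau> i)
        * q (w l) powi (- t i (w l) * (1 - \<tau> l)) * q (w l) powi (t i (w l) * \<tau> l) = 1) \<and>
     (\<forall>i\<in>{1..r}. eqA n d q
        (fa_mult (laurent_eval (p i) (w i)) (fa_mult (laurent_eval (p' i) (w i))
           (fa_diff (fa_scal (q (w i) powi ((1 - \<tau> i) * int d)) (hpow (w i) (int d))) fa_one)))
        (fa_diff (fa_scal ((qt i * \<gamma> i) ^ d) (hpow (w i) (m i * int d))) fa_one)) \<and>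
     (\<forall>i\<in>{1..r}. \<gamma> i ^ d = qt i powi (- (\<tau> i * int d))) \<and>
     (\<forall>i\<in>{1..r}.
        eqA n d q (Psi (fa_gen (GH i))) (fa_scal (\<gamma> i) (hpow (w i) (m i))) \<and>
        eqA n d q (Psi (fa_gen (GX i)))
          (fa_mult (laurent_eval (p i) (w i)) (fa_scal (b i) (fa_mult (hmono n (t i))
             (fa_gen (if \<tau> i = 0 then GX (w i) else GY (w i)))))) \<and>
        eqA n d q (Psi (fa_gen (GY i)))
          (fa_mult (fa_gen (if \<tau> i = 0 then GY (w i) else GX (w i)))
             (fa_mult (laurent_eval (p' i) (w i)) (fa_scal (inverse (b i))
                (hmono n (\<lambda>j. - t i j))))))"
proof -
  interpret gwa_hom n r d q qt Psi
    by unfold_locales (use assms in auto)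
  let ?X = "\<lambda>i. fa_word [GX i]" and ?Y = "\<lambda>i. fa_word [GY i]" and ?H = "\<lambda>i. fa_word [GH i]"
  \<comment> \<open>All that \<open>triple_form\<close> gives for one index, packed so that choice
    can be applied to the components one after the other. F is kept because injectivity and (ii)
    depend on it.\<close>
  let ?Q = "\<lambda>i j \<tau> m \<gamma> t p p' F. j \<in> {1..n} \<and> \<tau> \<in> {0, 1 :: int} \<and> m \<noteq> 0 \<and> \<gamma> \<noteq> 0 \<and> p \<in> laurent \<and> p' \<in> laurent \<and>
      img (?H i) = single 0 (single (single j m) \<gamma>) \<and>
      q j powi ((-1) ^ nat \<tau> * m) = qt i \<and> \<gamma> ^ d = qt i powi (- (\<tau> * int d)) \<and>
      fa_mult (laurent_eval p j) (fa_mult (laurent_eval p' j)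
         (fa_diff (fa_scal (q j powi ((1 - \<tau>) * int d)) (hpow j (int d))) fa_one))
       \<approx> fa_diff (fa_scal ((qt i * \<gamma>) ^ d) (hpow j (m * int d))) fa_one \<and>
      Psi (?H i) \<approx> fa_scal \<gamma> (hpow j m) \<and>
      Psi (?X i) \<approx> fa_mult (laurent_eval p j) (fa_mult (hmono n (coeff t)) (fa_gen (if \<tau> = 0 then GX j else GY j))) \<and>
      Psi (?Y i) \<approx> fa_mult (fa_gen (if \<tau> = 0 then GY j else GX j)) (fa_mult (laurent_eval p' j) (hmono n (\<lambda>i. - coeff t i))) \<and>
      coeff t j = 0 \<and> img (?X i) = single (single j (1 - 2 * \<tau>)) F \<and> F \<noteq> 0 \<and> (\<forall>a\<in>keys F. omit j a = t)"
  have "\<exists>j \<tau> m \<gamma> t p p' F. ?Q i j \<tau> m \<gamma> t p p' F" if i: "i \<in> {1..r}" for i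
  proof -
    obtain \<mu> \<gamma> where *: "\<gamma> \<noteq> 0" "img (?H i) = single 0 (single \<mu> \<gamma>)"
      "\<And>\<beta>. coeff (tmult (img (?X i)) (img (?H i))) \<beta> = single 0 (qt i) * coeff (tmult (img (?H i)) (img (?X i))) \<beta>"
      "tmult (img (?X i)) (img (?Y i)) = single 0 (single 0 (qt i ^ d) * single \<mu> \<gamma> ^ d - 1)"
      "tmult (img (?Y i)) (img (?X i)) = single 0 (single \<mu> \<gamma> ^ d - 1)"
      using img_triple[OF i] by blast
    have "Psi (?X i) \<in> free_alg n" "Psi (?Y i) \<in> free_alg n" "Psi (?H i) \<in> free_alg n"
      using i by (simp_all add: Psi_free_alg fa_word_free_alg)
    then obtain j m t p p' F and \<tau> :: int
    where "j \<in> {1..n}" "\<tau> \<in> {0, 1}" "m \<noteq> 0" "p \<in> laurent" "p' \<in> laurent"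
      "symbol (Psi (?H i)) = single 0 (single (single j m) \<gamma>)"
      "q j powi ((-1) ^ nat \<tau> * m) = qt i" "\<gamma> ^ d = qt i powi (- (\<tau> * int d))"
      "fa_mult (laurent_eval p j) (fa_mult (laurent_eval p' j)
         (fa_diff (fa_scal (q j powi ((1 - \<tau>) * int d)) (hpow j (int d))) fa_one))
       \<approx> fa_diff (fa_scal ((qt i * \<gamma>) ^ d) (hpow j (m * int d))) fa_one"
      "Psi (?H i) \<approx> fa_scal \<gamma> (hpow j m)"
      "Psi (?X i) \<approx> fa_mult (laurent_eval p j) (fa_mult (hmono n (coeff t)) (fa_gen (if \<tau> = 0 then GX j else GY j)))"
      "Psi (?Y i) \<approx> fa_mult (fa_gen (if \<tau> = 0 then GY j else GX j)) (fa_mult (laurent_eval p' j) (hmono n (\<lambda>i. - coeff t i)))"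
      "coeff t j = 0" "symbol (Psi (?X i)) = single (single j (1 - 2 * \<tau>)) F" "F \<noteq> 0" "\<And>a. a \<in> keys F \<Longrightarrow> omit j a = t"
      by (rule triple_form[OF _ _ _ *(2)[unfolded img_def] *(1) source.q_nonzero[OF i] qt_root[OF i]
            *(3)[unfolded img_def] *(4)[unfolded img_def] *(5)[unfolded img_def]]) blast+
    then show ?thesis unfolding img_def using *(1) by blast
  qed
  then have "\<forall>i\<in>{1..r}. \<exists>j \<tau> m \<gamma> t p p' F. ?Q i j \<tau> m \<gamma> t p p' F" by blast
  from bchoice[OF this] obtain w where "\<forall>i\<in>{1..r}. \<exists>\<tau> m \<gamma> t p p' F. ?Q i (w i) \<tau> m \<gamma> t p p' F" by blast
  from bchoice[OF this] obtain \<tau> where "\<forall>i\<in>{1..r}. \<exists>m \<gamma> t p p' F. ?Q i (w i) (\<tau> i) m \<gamma> t p p' F" by blast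
  from bchoice[OF this] obtain m where "\<forall>i\<in>{1..r}. \<exists>\<gamma> t p p' F. ?Q i (w i) (\<tau> i) (m i) \<gamma> t p p' F" by blast
  from bchoice[OF this] obtain \<gamma> where "\<forall>i\<in>{1..r}. \<exists>t p p' F. ?Q i (w i) (\<tau> i) (m i) (\<gamma> i) t p p' F" by blast
  from bchoice[OF this] obtain t where "\<forall>i\<in>{1..r}. \<exists>p p' F. ?Q i (w i) (\<tau> i) (m i) (\<gamma> i) (t i) p p' F" by blast
  from bchoice[OF this] obtain p where "\<forall>i\<in>{1..r}. \<exists>p' F. ?Q i (w i) (\<tau> i) (m i) (\<gamma> i) (t i) (p i) p' F" by blast
  from bchoice[OF this] obtain p' where "\<forall>i\<in>{1..r}. \<exists>F. ?Q i (w i) (\<tau> i) (m i) (\<gamma> i) (t i) (p i) (p' i) F" by blast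
  from bchoice[OF this] obtain F where Q: "\<forall>i\<in>{1..r}. ?Q i (w i) (\<tau> i) (m i) (\<gamma> i) (t i) (p i) (p' i) (F i)" by blast
  have w_range: "w i \<in> {1..n}" and \<tau>: "\<tau> i \<in> {0, 1}" and imgH: "img (?H i) = single 0 (single (single (w i) (m i)) (\<gamma> i))"
    and qt_eq: "q (w i) powi ((-1) ^ nat (\<tau> i) * m i) = qt i" and \<gamma>: "\<gamma> i \<noteq> 0" and tw: "coeff (t i) (w i) = 0"
    and imgX: "img (?X i) = single (single (w i) (1 - 2 * \<tau> i)) (F i)" and F: "F i \<noteq> 0"
    and F_keys: "\<And>a. a \<in> keys (F i) \<Longrightarrow> omit (w i) a = t i" if "i \<in> {1..r}" for i
    using bspec[OF Q that] by blast+
  \<comment> \<open>For i \<noteq> l the images of x_l and h_i commute. If both live at the same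
    index, moving X^(\<plusminus>1) past h^(m_i) costs q^(\<plusminus>m_i), which must be 1; this
    power is \<open>qt i\<close> up to inversion.\<close>
  have inj: "inj_on w {1..r}"
  proof (rule inj_onI, rule ccontr)
    fix i l assume i: "i \<in> {1..r}" and l: "l \<in> {1..r}" and eq: "w i = w l" and "i \<noteq> l"
    let ?c = "q (w l) powi ((1 - 2 * \<tau> l) * m i)"
    have "tmult (img (?X l)) (img (?H i)) = tmult (img (?H i)) (img (?X l))"
      by (rule img_commute) (use i l \<open>i \<noteq> l\<close> in simp_all)
    then have "F l * twist (single (w l) (1 - 2 * \<tau> l)) (single (single (w l) (m i)) (\<gamma> i)) =
        single (single (w l) (m i)) (\<gamma> i) * F l"
      unfolding imgX[OF l] imgH[OF i] eq twisted_mult_single add_0 add_0_right twist_0 by (rule single_inject)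
    then have "F l * single (single (w l) (m i)) (?c * \<gamma> i) = single (single (w l) (m i)) (\<gamma> i) * F l"
      by (simp only: twist_single chi_single_left[OF w_range[OF l]] lookup_single_eq)
    then have "single (single (w l) (m i)) (?c * \<gamma> i) = single (single (w l) (m i)) (\<gamma> i)"
      using F[OF l] by (simp add: mult.commute)
    then have "?c * \<gamma> i = \<gamma> i" by (metis lookup_single_eq)
    then have c: "?c = 1" using \<gamma>[OF i] by simp
    have "q (w i) powi (m i) = 1"
      using \<tau>[OF l] c eq by (auto simp: power_int_minus)
    then have "qt i = 1" using qt_eq[OF i] \<tau>[OF i] by (auto simp: power_int_minus)
    then show False using qt_root[OF i] by simp
  qed
  \<comment> \<open>F_i is homogeneous in h_w(l) of degree t_(i,w(l)), so commuting x_i with x_l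
    compares two scalars. The sign 1 - 2\<tau> equals (-1)^\<tau>.\<close>
  have comm: "q (w i) powi ((1 - 2 * \<tau> i) * coeff (t l) (w i)) = q (w l) powi ((1 - 2 * \<tau> l) * coeff (t i) (w l))"
    if i: "i \<in> {1..r}" and l: "l \<in> {1..r}" and "i \<noteq> l" for i l
  proof -
    have ne: "w i \<noteq> w l" using inj_onD[OF inj] i l \<open>i \<noteq> l\<close> by blast
    have tw: "twist (single (w i) s) (F l) = single 0 (q (w i) powi (s * coeff (t l) (w i))) * F l"
      if "i \<in> {1..r}" "l \<in> {1..r}" "w i \<noteq> w l" for i l s
    proof (rule twist_homogeneous[OF w_range[OF that(1)]])
      fix a assume "a \<in> keys (F l)"
      then have "omit (w l) a = t l" by (rule F_keys[OF that(2)])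
      then show "coeff a (w i) = coeff (t l) (w i)" using that(3) lookup_omit[of "w l" a "w i"] by simp
    qed
    let ?a = "q (w i) powi ((1 - 2 * \<tau> i) * coeff (t l) (w i))" and ?b = "q (w l) powi ((1 - 2 * \<tau> l) * coeff (t i) (w l))"
    have "tmult (img (?X i)) (img (?X l)) = tmult (img (?X l)) (img (?X i))"
      by (rule img_commute) (use i l \<open>i \<noteq> l\<close> in simp_all)
    then have "F i * (single 0 ?a * F l) = F l * (single 0 ?b * F i)"
      unfolding imgX[OF i] imgX[OF l] twisted_mult_single tw[OF i l ne] tw[OF l i ne[symmetric]]
      by (metis add.commute lookup_single_eq)
    then have "(F i * F l) * single 0 ?a = (F i * F l) * single 0 ?b" by (simp add: mult_ac)
    then have "single 0 ?a = (single 0 ?b :: 'k lau)" using F[OF i] F[OF l] by simp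
    then show ?thesis by (metis lookup_single_eq)
  qed
  have rel: "q (w i) powi (coeff (t l) (w i) * (1 - \<tau> i)) * q (w i) powi (- coeff (t l) (w i) * \<tau> i)
        * q (w l) powi (- coeff (t i) (w l) * (1 - \<tau> l)) * q (w l) powi (coeff (t i) (w l) * \<tau> l) = 1"
    if i: "i \<in> {1..r}" and l: "l \<in> {1..r}" for i l
  proof (cases "i = l")
    case True
    then show ?thesis using tw[OF i] by simp
  next
    case False
    have "q (w i) \<noteq> 0" "q (w l) \<noteq> 0" using q_nonzero w_range i l by blast+
    then show ?thesis using comm[OF i l False] \<tau>[OF i] \<tau>[OF l] by (auto simp: power_int_minus)
  qed
  \<comment> \<open>The scalars b are all 1, since p and p' already contain them.\<close>
  show ?thesis
    by (rule exI[of _ w], rule exI[of _ \<tau>], rule exI[of _ m], rule exI[of _ \<gamma>], rule exI[of _ "\<lambda>_. 1"],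
      rule exI[of _ "\<lambda>i. coeff (t i)"], rule exI[of _ p], rule exI[of _ p'])
      (use Q inj rel in \<open>auto simp: fa_gen_eq\<close>)
qed

end
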